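(* (Upper bound.) Let $\mathbb{F}$ be a field and let $G$ be an algebraic graph of description complexity at most $t$ on the vertex set $\mathcal{P}\cup\mathcal{Q}$, where $\mathcal{P}\subseteq\mathbb{F}^{d_1}$, $\mathcal{Q}\subseteq\mathbb{F}^{d_2}$ and $|\mathcal{P}|=m$, $|\mathcal{Q}|=n$. If $G$ is $K_{s,s}$-free, then the number of edges in $G$ is at most $$O_{d_1,d_2,t,s}\big(\min\{m^{1-1/d_1}n,\; mn^{1-1/d_2}\}\big).$$ (Tightness.) Moreover, this bound is tight: for every $d_1,d_2$ there exists $t$ such that if $m,n$ are sufficiently large and $s\geq d_1+d_2$, then there exist a field $\mathbb{F}$ and a $K_{s,s}$-free algebraic graph $G$ of description complexity at most $t$ in $(\mathbb{F}^{d_1},\mathbb{F}^{d_2})$ with parts of size $m,n$ and at least $\Omega\big(\min\{m^{1-1/d_1}n,\; mn^{1-1/d_2}\}\big)$ edges.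
   Context: Given sets of points $\mathcal{P}\subseteq\mathbb{F}^{d_1}$, $\mathcal{Q}\subseteq\mathbb{F}^{d_2}$, polynomials $f_1,\dots,f_t:\mathbb{F}^{d_1}\times\mathbb{F}^{d_2}\to\mathbb{F}$ and a boolean formula $\Phi$, define the bipartite graph $G$ on the vertex set $\mathcal{P}\cup\mathcal{Q}$ where $x\in\mathcal{P}$ and $y\in\mathcal{Q}$ are adjacent iff $\Phi([f_1(x,y)=0],\dots,[f_t(x,y)=0])=1$ (with $[\cdot]$ the truth value). $G$ is an algebraic graph of description complexity $t$, in $(\mathbb{F}^{d_1},\mathbb{F}^{d_2})$, if it can be described in this way by $t$ polynomials $f_1,\dots,f_t$, each of degree at most $t$. $K_{s,s}$-free means not containing the complete bipartite graph with vertex classes of size $s$ as a subgraph. Subscripts on $O$ list the parameters on which the implied constant may depend.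
   Formalization: The upper bound is proved as O(min{...}+m+n): without +m+n it fails for stars (one point joined to all n points is K_{2,2}-free), and for n≤m^{d2}, m≤n^{d1} it gives the printed bound. Fields are taken within one arbitrary type; countable subfields give a constant for all fields. *)

theory Defs
  imports Complex_Main "HOL-Algebra.Indexed_Polynomials"
begin

text \<open>
  Fields are \<open>HOL-Algebra\<close> records, so that a bound can be uniform in the field. Points of
  \<open>F^d\<close> are extensional functions on \<open>{..<d}\<close>. A polynomial on \<open>F^d1 \<times> F^d2\<close> is an indexed
  polynomial whose variables are \<open>Inl i\<close> (\<open>i < d1\<close>, coordinates of the first point) and
  \<open>Inr j\<close> (\<open>j < d2\<close>, coordinates of the second point).
\<close>

definition affine_space :: "'a ring \<Rightarrow> nat \<Rightarrow> (nat \<Rightarrow> 'a) set" where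
  "affine_space R d = ({..<d} \<rightarrow>\<^sub>E carrier R)"

definition bipoly_set :: "'a ring \<Rightarrow> nat \<Rightarrow> nat \<Rightarrow> ((nat + nat) multiset \<Rightarrow> 'a) set" where
  "bipoly_set R d1 d2 = ring.indexed_pset R ({..<d1} <+> {..<d2}) (carrier R)"

text \<open>Total degree; the zero polynomial has degree at most every \<open>k\<close>.\<close>

definition total_degree_le :: "'a ring \<Rightarrow> ('v multiset \<Rightarrow> 'a) \<Rightarrow> nat \<Rightarrow> bool" where
  "total_degree_le R f k \<longleftrightarrow> (\<forall>M. f M \<noteq> \<zero>\<^bsub>R\<^esub> \<longrightarrow> size M \<le> k)"

definition indexed_poly_eval :: "'a ring \<Rightarrow> ('v multiset \<Rightarrow> 'a) \<Rightarrow> ('v \<Rightarrow> 'a) \<Rightarrow> 'a" where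
  "indexed_poly_eval R f z =
     (\<Oplus>\<^bsub>R\<^esub>M\<in>{M. f M \<noteq> \<zero>\<^bsub>R\<^esub>}. f M \<otimes>\<^bsub>R\<^esub> (\<Otimes>\<^bsub>R\<^esub>v\<in>set_mset M. z v [^]\<^bsub>R\<^esub> count M v))"

text \<open>
  The two parts are made disjoint by \<open>Inl\<close> and \<open>Inr\<close>; an edge is an unordered pair.
  The boolean formula in the truth values \<open>[f_i(x, y) = 0]\<close> enters through the boolean function
  that it computes.
\<close>

definition zero_pattern_edges ::
  "'a ring \<Rightarrow> ((nat + nat) multiset \<Rightarrow> 'a) list \<Rightarrow> (bool list \<Rightarrow> bool) \<Rightarrow>
   (nat \<Rightarrow> 'a) set \<Rightarrow> (nat \<Rightarrow> 'a) set \<Rightarrow> ((nat \<Rightarrow> 'a) + (nat \<Rightarrow> 'a)) set set" where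
  "zero_pattern_edges R fs \<Phi> P Q =
     {{Inl x, Inr y} | x y. x \<in> P \<and> y \<in> Q \<and>
        \<Phi> (map (\<lambda>f. indexed_poly_eval R f (case_sum x y) = \<zero>\<^bsub>R\<^esub>) fs)}"

definition algebraic_graph ::
  "'a ring \<Rightarrow> nat \<Rightarrow> nat \<Rightarrow> nat \<Rightarrow> (nat \<Rightarrow> 'a) set \<Rightarrow> (nat \<Rightarrow> 'a) set \<Rightarrow>
   ((nat \<Rightarrow> 'a) + (nat \<Rightarrow> 'a)) set set \<Rightarrow> bool" where
  "algebraic_graph R d1 d2 t P Q E \<longleftrightarrow>
     P \<subseteq> affine_space R d1 \<and> Q \<subseteq> affine_space R d2 \<and>
     (\<exists>fs \<Phi>. length fs = t \<and>
        (\<forall>f\<in>set fs. f \<in> bipoly_set R d1 d2 \<and> total_degree_le R f t) \<and>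
        E = zero_pattern_edges R fs \<Phi> P Q)"

definition algebraic_graph_le ::
  "'a ring \<Rightarrow> nat \<Rightarrow> nat \<Rightarrow> nat \<Rightarrow> (nat \<Rightarrow> 'a) set \<Rightarrow> (nat \<Rightarrow> 'a) set \<Rightarrow>
   ((nat \<Rightarrow> 'a) + (nat \<Rightarrow> 'a)) set set \<Rightarrow> bool" where
  "algebraic_graph_le R d1 d2 t P Q E \<longleftrightarrow> (\<exists>t'\<le>t. algebraic_graph R d1 d2 t' P Q E)"

definition biclique_free :: "nat \<Rightarrow> 'v set \<Rightarrow> 'v set set \<Rightarrow> bool" where
  "biclique_free s V E \<longleftrightarrow>
     \<not> (\<exists>A B. A \<subseteq> V \<and> B \<subseteq> V \<and> A \<inter> B = {} \<and>
            finite A \<and> finite B \<and> card A = s \<and> card B = s \<and>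
            (\<forall>a\<in>A. \<forall>b\<in>B. {a, b} \<in> E))"

text \<open>
  The quantity \<open>min {m^(1-1/d1) n, m n^(1-1/d2)}\<close>. Up to a constant factor it dominates \<open>m + n\<close>
  exactly when \<open>n\<close> is at most of order \<open>m^d2\<close> and \<open>m\<close> is at most of order \<open>n^d1\<close>. Outside this
  range it is not by itself an upper bound on the number of edges: one point of the first part
  joined to all \<open>n\<close> points of the second is \<open>K_{2,2}\<close>-free with \<open>n\<close> edges, while the quantity
  is at most \<open>m n^(1-1/d2)\<close>. An upper bound valid for all \<open>m\<close> and \<open>n\<close> needs the additional
  terms \<open>m + n\<close>.
\<close>

definition zarankiewicz_term :: "nat \<Rightarrow> nat \<Rightarrow> nat \<Rightarrow> nat \<Rightarrow> real" where
  "zarankiewicz_term d1 d2 m n =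
     min (real m powr (1 - 1 / real d1) * real n) (real m * real n powr (1 - 1 / real d2))"

end

theory Submission
  imports Defs "HOL-Number_Theory.Residues" "HOL-Real_Asymp.Real_Asymp"
begin

text \<open>
  Upper bound. By the zero pattern theorem the neighbourhoods of the points of \<open>Q\<close> leave at most
  \<open>O(k^d2)\<close> different traces on a set of \<open>k\<close> points of \<open>P\<close>. Suppose that all vertices of \<open>Q\<close> have
  degree much larger than \<open>m / n^(1/d2)\<close>. Then some sample of \<open>k\<close> points, with \<open>k\<close> a small multiple of
  \<open>n^(1/d2)\<close>, contains \<open>s\<close> neighbours of at least half of the vertices of \<open>Q\<close>, and these have so few
  traces that \<open>s\<close> of them share one, which is a copy of \<open>K_{s,s}\<close>. So there is always a vertex of
  degree \<open>O(m / n^(1/d2) + 1)\<close>, and removing such vertices one by one gives the bound for \<open>d2 \<ge> 2\<close>. For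
  \<open>d2 = 1\<close> every neighbourhood of a point of \<open>P\<close> has at most \<open>t^2\<close> elements or misses at most
  \<open>t^2\<close> points of \<open>Q\<close>.

  Tightness. Let \<open>q \<ge> max(m^(1/d1), n^(1/d2))\<close> be a prime of the same order and \<open>s = d1 + d2\<close>. A
  random polynomial of degree at most \<open>s^2\<close> over the field with \<open>q\<close> elements vanishes on a given set
  of \<open>s^2\<close> points with probability \<open>q^(-s^2)\<close>. Hence the expected number of edges is \<open>m n / q\<close>,
  while the expected number of copies of \<open>K_{s,s}\<close> is at most \<open>1/4\<close>.
\<close>

section \<open>Polynomial functions in finitely many variables\<close>

text \<open>A sample of \<open>k\<close> points of one part yields at most \<open>t * k\<close>
  polynomials on the other. Their products have degree at most \<open>t * t * k\<close>, and
  counting the exponents of monomials up to that degree gives traces of order \<open>k ^ d2\<close>.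
  The minimum in the bound comes from running the argument in both orders of the parts. In the lower
  bound, \<open>s = d1 + d2\<close> is the value at which the count balances: with
  \<open>m \<le> q ^ d1\<close> and \<open>n \<le> q ^ d2\<close> there are at most
  \<open>q ^ (s * s) / 4\<close> possible bicliques, the inverse of the probability of each up to
  the factor 4. Zeros are weighted against bicliques jointly, so the values at
  \<open>s * s + 1\<close> points have to be independent, and degree \<open>s * s\<close> is what
  provides this. Only the order of magnitude of \<open>q\<close> matters; a prime between
  \<open>M\<close> and \<open>8 * M\<close> suffices, and crude bounds on least common multiples and
  primorials supply it.\<close>

definition monomials :: "'v set \<Rightarrow> nat \<Rightarrow> 'v multiset set" where
  "monomials I k = {M. set_mset M \<subseteq> I \<and> size M \<le> k}"

text \<open>A monomial is determined by its exponents, each at most \<open>k\<close>. This box is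
  cruder than a binomial coefficient but has the right order in \<open>k\<close>, and for one
  variable it gives the exact dimension \<open>k + 1\<close>.\<close>

lemma monomials_finite_card:
  assumes "finite I"
  shows "finite (monomials I k) \<and> card (monomials I k) \<le> (k + 1) ^ card I"
proof -
  let ?\<phi> = "\<lambda>M. restrict (count M) I"
  have "inj_on ?\<phi> (monomials I k)"
  proof (rule inj_onI)
    fix M N assume *: "M \<in> monomials I k" "N \<in> monomials I k" "?\<phi> M = ?\<phi> N"
    have "count M v = count N v" for v
    proof (cases "v \<in> I")
      case True
      then show ?thesis using fun_cong[OF *(3), of v] by simp
    next
      case False
      then show ?thesis using * unfolding monomials_def by (metis (no_types, lifting) mem_Collect_eq not_in_iff subsetD)
    qed
    then show "M = N" by (rule multiset_eqI)
  qed
  moreover have "?\<phi> ` monomials I k \<subseteq> I \<rightarrow>\<^sub>E {..k}"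
    unfolding monomials_def by (auto intro: order_trans[OF count_le_size])
  moreover have "finite (I \<rightarrow>\<^sub>E {..k})" "card (I \<rightarrow>\<^sub>E {..k}) = (k + 1) ^ card I"
    using assms by (auto simp: finite_PiE card_PiE)
  ultimately show ?thesis
    by (metis card_inj_on_le inj_on_finite)
qed

lemmas finite_monomials = monomials_finite_card[THEN conjunct1]
lemmas card_monomials_le = monomials_finite_card[THEN conjunct2]

section \<open>Evaluation of monomials and polynomial functions over a commutative ring\<close>

context cring
begin

lemma finsum_neutral_superset:
  assumes "finite B" "A \<subseteq> B" "\<And>x. x \<in> B - A \<Longrightarrow> f x = \<zero>" "f \<in> B \<rightarrow> carrier R"
  shows "finsum R f A = finsum R f B"
  using add.finprod_mono_neutral_cong_left[of B A f f] assms by (auto simp: Pi_def)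

definition monomial_at :: "'v multiset \<Rightarrow> ('v \<Rightarrow> 'a) \<Rightarrow> 'a" where
  "monomial_at M z = (\<Otimes>v\<in>set_mset M. z v [^] count M v)"

lemma monomial_at_empty [simp]: "monomial_at {#} z = \<one>"
  by (simp add: monomial_at_def)

lemma monomial_at_closed [intro]:
  assumes "z \<in> set_mset M \<rightarrow> carrier R"
  shows "monomial_at M z \<in> carrier R"
  unfolding monomial_at_def using assms by (intro finprod_closed) auto

lemma monomial_at_superset:
  assumes "finite A" "set_mset M \<subseteq> A" "z \<in> A \<rightarrow> carrier R"
  shows "monomial_at M z = (\<Otimes>v\<in>A. z v [^] count M v)"
  unfolding monomial_at_def using assms
  by (intro finprod_mono_neutral_cong_left) (auto simp: not_in_iff)

lemma monomial_at_add:
  assumes "z \<in> set_mset (M + N) \<rightarrow> carrier R"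
  shows "monomial_at (M + N) z = monomial_at M z \<otimes> monomial_at N z"
proof -
  let ?A = "set_mset (M + N)"
  have "monomial_at (M + N) z = (\<Otimes>v\<in>?A. z v [^] count M v \<otimes> z v [^] count N v)"
    unfolding monomial_at_def using assms by (intro finprod_cong') (auto simp: nat_pow_mult[symmetric] Pi_iff)
  also have "\<dots> = (\<Otimes>v\<in>?A. z v [^] count M v) \<otimes> (\<Otimes>v\<in>?A. z v [^] count N v)"
    using assms by (intro finprod_multf) auto
  also have "\<dots> = monomial_at M z \<otimes> monomial_at N z"
    using assms by (subst (1 2) monomial_at_superset[of ?A]) auto
  finally show ?thesis .
qed

lemma monomial_at_cong:
  assumes "z \<in> set_mset M \<rightarrow> carrier R" "\<And>v. v \<in># M \<Longrightarrow> w v = z v"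
  shows "monomial_at M w = monomial_at M z"
  unfolding monomial_at_def using assms by (intro finprod_cong') auto

text \<open>Polynomials are handled as functions, constrained only at points whose coordinates in
  \<open>I\<close> lie in the carrier. Sums and products are then pointwise, and coefficients are
  needed only in the closure lemmas and in the dimension count.\<close>

definition poly_funs :: "'v set \<Rightarrow> nat \<Rightarrow> (('v \<Rightarrow> 'a) \<Rightarrow> 'a) set" where
  "poly_funs I k = {h. \<exists>c\<in>UNIV \<rightarrow> carrier R. \<forall>z\<in>I \<rightarrow> carrier R.
     h z = (\<Oplus>M\<in>monomials I k. c M \<otimes> monomial_at M z)}"

lemma monomial_at_monomials_closed:
  "M \<in> monomials I k \<Longrightarrow> z \<in> I \<rightarrow> carrier R \<Longrightarrow> monomial_at M z \<in> carrier R"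
  unfolding monomials_def by blast

lemma poly_funs_closed:
  assumes "h \<in> poly_funs I k" "z \<in> I \<rightarrow> carrier R"
  shows "h z \<in> carrier R"
  using assms monomial_at_monomials_closed[of _ I k z] unfolding poly_funs_def
  by (fastforce intro!: finsum_closed m_closed)

lemma poly_funs_cong:
  assumes "h \<in> poly_funs I k" "\<And>z. z \<in> I \<rightarrow> carrier R \<Longrightarrow> h' z = h z"
  shows "h' \<in> poly_funs I k"
  using assms unfolding poly_funs_def by auto

lemma poly_funs_monomial:
  assumes "finite I" "M \<in> monomials I k" "a \<in> carrier R"
  shows "(\<lambda>z. a \<otimes> monomial_at M z) \<in> poly_funs I k"
  unfolding poly_funs_def
proof (intro CollectI bexI[of _ "\<lambda>N. if N = M then a else \<zero>"] ballI)
  fix z assume z: "z \<in> I \<rightarrow> carrier R"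
  let ?f = "\<lambda>N. (if N = M then a else \<zero>) \<otimes> monomial_at N z"
  have "finsum R ?f {M} = finsum R ?f (monomials I k)"
    using assms z monomial_at_monomials_closed[OF _ z]
    by (intro finsum_neutral_superset finite_monomials) auto
  moreover have "finsum R ?f {M} = a \<otimes> monomial_at M z"
    using assms z monomial_at_monomials_closed[OF assms(2) z] by (simp add: finsum_insert)
  ultimately show "a \<otimes> monomial_at M z = finsum R ?f (monomials I k)" by simp
qed (use assms in auto)

lemma poly_funs_zero: "(\<lambda>_. \<zero>) \<in> poly_funs I k"
  unfolding poly_funs_def
proof (intro CollectI bexI[of _ "\<lambda>_. \<zero>"] ballI)
  fix z assume z: "z \<in> I \<rightarrow> carrier R"
  show "\<zero> = (\<Oplus>M\<in>monomials I k. \<zero> \<otimes> monomial_at M z)"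
    using monomial_at_monomials_closed[OF _ z] by (simp add: add.finprod_one_eqI)
qed auto

lemma poly_funs_add:
  assumes "g \<in> poly_funs I k" "h \<in> poly_funs I k"
  shows "(\<lambda>z. g z \<oplus> h z) \<in> poly_funs I k"
proof -
  obtain c d where cd: "c \<in> UNIV \<rightarrow> carrier R" "d \<in> UNIV \<rightarrow> carrier R"
    "\<And>z. z \<in> I \<rightarrow> carrier R \<Longrightarrow> g z = (\<Oplus>M\<in>monomials I k. c M \<otimes> monomial_at M z)"
    "\<And>z. z \<in> I \<rightarrow> carrier R \<Longrightarrow> h z = (\<Oplus>M\<in>monomials I k. d M \<otimes> monomial_at M z)"
    using assms unfolding poly_funs_def by blast
  show ?thesis
    unfolding poly_funs_def
  proof (intro CollectI bexI[of _ "\<lambda>M. c M \<oplus> d M"] ballI)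
    fix z assume z: "z \<in> I \<rightarrow> carrier R"
    have cl: "c M \<in> carrier R" "d M \<in> carrier R" for M using cd by auto
    note m = monomial_at_monomials_closed[OF _ z]
    have "(\<Oplus>M\<in>monomials I k. (c M \<oplus> d M) \<otimes> monomial_at M z) =
      (\<Oplus>M\<in>monomials I k. c M \<otimes> monomial_at M z \<oplus> d M \<otimes> monomial_at M z)"
      using cl m by (intro finsum_cong') (auto simp: l_distr)
    also have "\<dots> = g z \<oplus> h z"
      using cl m by (subst finsum_addf) (auto simp: cd(3,4)[OF z])
    finally show "g z \<oplus> h z = (\<Oplus>M\<in>monomials I k. (c M \<oplus> d M) \<otimes> monomial_at M z)" ..
  qed (use cd in auto)
qed

lemma poly_funs_finsum:
  assumes "finite A" "\<And>i. i \<in> A \<Longrightarrow> h i \<in> poly_funs I k"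
  shows "(\<lambda>z. \<Oplus>i\<in>A. h i z) \<in> poly_funs I k"
  using assms
proof (induction A)
  case empty
  then show ?case by (simp add: poly_funs_zero)
next
  case (insert i A)
  then have *: "(\<lambda>z. h i z \<oplus> (\<Oplus>i\<in>A. h i z)) \<in> poly_funs I k"
    by (intro poly_funs_add) auto
  have cl: "h j z \<in> carrier R" if "j \<in> insert i A" "z \<in> I \<rightarrow> carrier R" for j z
    using insert.prems poly_funs_closed that by blast
  show ?case
    by (rule poly_funs_cong[OF *], rule finsum_insert) (use insert.hyps cl in auto)
qed

lemma poly_funs_mult:
  assumes "finite I" "g \<in> poly_funs I k" "h \<in> poly_funs I l"
  shows "(\<lambda>z. g z \<otimes> h z) \<in> poly_funs I (k + l)"
proof -
  obtain c d where cd: "c \<in> UNIV \<rightarrow> carrier R" "d \<in> UNIV \<rightarrow> carrier R"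
    "\<And>z. z \<in> I \<rightarrow> carrier R \<Longrightarrow> g z = (\<Oplus>M\<in>monomials I k. c M \<otimes> monomial_at M z)"
    "\<And>z. z \<in> I \<rightarrow> carrier R \<Longrightarrow> h z = (\<Oplus>M\<in>monomials I l. d M \<otimes> monomial_at M z)"
    using assms unfolding poly_funs_def by blast
  have cl: "c M \<in> carrier R" "d M \<in> carrier R" for M using cd by auto
  have "(\<lambda>z. \<Oplus>M\<in>monomials I k. \<Oplus>N\<in>monomials I l. (c M \<otimes> d N) \<otimes> monomial_at (M + N) z)
    \<in> poly_funs I (k + l)"
    using assms(1) cl
    by (intro poly_funs_finsum finite_monomials poly_funs_monomial) (auto simp: monomials_def)
  then show ?thesis
  proof (rule poly_funs_cong)
    fix z assume z: "z \<in> I \<rightarrow> carrier R"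
    note m = monomial_at_monomials_closed[OF _ z]
    have eq: "(\<Oplus>N\<in>monomials I l. (c M \<otimes> d N) \<otimes> monomial_at (M + N) z) = c M \<otimes> monomial_at M z \<otimes> h z"
      if M: "M \<in> monomials I k" for M
    proof -
      have "(\<Oplus>N\<in>monomials I l. (c M \<otimes> d N) \<otimes> monomial_at (M + N) z) =
        (\<Oplus>N\<in>monomials I l. (c M \<otimes> monomial_at M z) \<otimes> (d N \<otimes> monomial_at N z))"
      proof (rule finsum_cong')
        fix N assume N: "N \<in> monomials I l"
        have "monomial_at (M + N) z = monomial_at M z \<otimes> monomial_at N z"
          using M N z unfolding monomials_def by (intro monomial_at_add) auto
        then show "(c M \<otimes> d N) \<otimes> monomial_at (M + N) z =
          (c M \<otimes> monomial_at M z) \<otimes> (d N \<otimes> monomial_at N z)"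
          using m[OF M] m[OF N] cl by (simp add: m_ac)
      qed (use m[OF M] m cl in auto)
      also have "\<dots> = c M \<otimes> monomial_at M z \<otimes> h z"
        unfolding cd(4)[OF z] using m[OF M] m cl finite_monomials[OF assms(1)]
        by (intro finsum_rdistr[symmetric]) auto
      finally show ?thesis .
    qed
    have "(\<Oplus>M\<in>monomials I k. \<Oplus>N\<in>monomials I l. (c M \<otimes> d N) \<otimes> monomial_at (M + N) z) =
      (\<Oplus>M\<in>monomials I k. c M \<otimes> monomial_at M z \<otimes> h z)"
      using eq m cl poly_funs_closed[OF assms(3) z] by (intro finsum_cong') auto
    also have "\<dots> = g z \<otimes> h z"
      unfolding cd(3)[OF z] using m cl finite_monomials[OF assms(1)] poly_funs_closed[OF assms(3) z]
      by (intro finsum_ldistr[symmetric]) auto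
    finally show "g z \<otimes> h z =
      (\<Oplus>M\<in>monomials I k. \<Oplus>N\<in>monomials I l. (c M \<otimes> d N) \<otimes> monomial_at (M + N) z)" ..
  qed
qed

lemma poly_funs_const:
  assumes "finite I" "a \<in> carrier R"
  shows "(\<lambda>_. a) \<in> poly_funs I k"
  using poly_funs_monomial[OF assms(1) _ assms(2), of "{#}" k] assms(2) by (simp add: monomials_def)

lemma poly_funs_coord:
  assumes "finite I" "v \<in> I"
  shows "(\<lambda>z. z v) \<in> poly_funs I 1"
proof -
  have "(\<lambda>z. \<one> \<otimes> monomial_at {#v#} z) \<in> poly_funs I 1"
    using assms by (intro poly_funs_monomial) (auto simp: monomials_def)
  then show ?thesis
    by (rule poly_funs_cong) (use assms in \<open>auto simp: monomial_at_def Pi_iff\<close>)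
qed

text \<open>Multiplying by the constant one, read as a polynomial of degree \<open>l - k\<close>,
  avoids extending the family of coefficients.\<close>

lemma poly_funs_mono:
  assumes "finite I" "h \<in> poly_funs I k" "k \<le> l"
  shows "h \<in> poly_funs I l"
proof -
  have "(\<lambda>z. h z \<otimes> \<one>) \<in> poly_funs I (k + (l - k))"
    using assms by (intro poly_funs_mult poly_funs_const) auto
  then have "(\<lambda>z. h z \<otimes> \<one>) \<in> poly_funs I l" using assms by simp
  then show ?thesis
    by (rule poly_funs_cong) (simp add: poly_funs_closed[OF assms(2)])
qed

lemma poly_funs_finprod:
  assumes "finite I" "finite A" "\<And>i. i \<in> A \<Longrightarrow> h i \<in> poly_funs I k"
  shows "(\<lambda>z. \<Otimes>i\<in>A. h i z) \<in> poly_funs I (k * card A)"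
  using assms(2,3)
proof (induction A)
  case empty
  then show ?case using assms(1) by (simp add: poly_funs_const)
next
  case (insert i A)
  then have "(\<lambda>z. h i z \<otimes> (\<Otimes>i\<in>A. h i z)) \<in> poly_funs I (k + k * card A)"
    using assms(1) by (intro poly_funs_mult) auto
  then have *: "(\<lambda>z. h i z \<otimes> (\<Otimes>i\<in>A. h i z)) \<in> poly_funs I (k * card (insert i A))"
    using insert by simp
  have cl: "h j z \<in> carrier R" if "j \<in> insert i A" "z \<in> I \<rightarrow> carrier R" for j z
    using insert.prems poly_funs_closed that by blast
  show ?case
    by (rule poly_funs_cong[OF *], rule finprod_insert) (use insert.hyps cl in auto)
qed

section \<open>Passage between indexed polynomials and polynomial functions\<close>

lemma indexed_monomial_in_pset:
  assumes "set_mset M \<subseteq> I" "a \<in> carrier R"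
  shows "(\<lambda>N. if N = M then a else \<zero>) \<in> indexed_pset I (carrier R)"
  using assms
proof (induction M)
  case empty
  then show ?case
    using indexed_pset.indexed_const[of a "carrier R" I] by (simp add: indexed_const_def)
next
  case (add v M)
  have "indexed_pmult (\<lambda>N. if N = M then a else \<zero>) v \<in> indexed_pset I (carrier R)"
    using add by (intro indexed_pset.indexed_pmult) auto
  moreover have "indexed_pmult (\<lambda>N. if N = M then a else \<zero>) v = (\<lambda>N. if N = add_mset v M then a else \<zero>)"
    unfolding indexed_pmult_def by (auto simp: fun_eq_iff)
  ultimately show ?case by simp
qed

lemma indexed_pset_of_coeffs:
  assumes "finite A" "\<And>M. M \<in> A \<Longrightarrow> set_mset M \<subseteq> I" "c \<in> UNIV \<rightarrow> carrier R"
  shows "(\<lambda>N. if N \<in> A then c N else \<zero>) \<in> indexed_pset I (carrier R)"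
  using assms(1,2)
proof (induction A)
  case empty
  then show ?case
    using indexed_pset.indexed_const[of \<zero> "carrier R" I] by (simp add: indexed_const_def)
next
  case (insert M A)
  have cl: "c N \<in> carrier R" for N using assms(3) by auto
  have "indexed_padd (\<lambda>N. if N = M then c M else \<zero>) (\<lambda>N. if N \<in> A then c N else \<zero>)
    \<in> indexed_pset I (carrier R)"
    using insert cl by (intro indexed_pset.indexed_padd indexed_monomial_in_pset) auto
  moreover have "indexed_padd (\<lambda>N. if N = M then c M else \<zero>) (\<lambda>N. if N \<in> A then c N else \<zero>) =
    (\<lambda>N. if N \<in> insert M A then c N else \<zero>)"
    using insert cl unfolding indexed_padd_def by (auto simp: fun_eq_iff)
  ultimately show ?case by simp
qed

lemma indexed_pset_support:
  assumes "f \<in> indexed_pset I (carrier R)" "f M \<noteq> \<zero>"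
  shows "set_mset M \<subseteq> I"
  using assms
proof (induction arbitrary: M)
  case (indexed_const k)
  then show ?case by (auto simp: indexed_const_def split: if_splits)
next
  case (indexed_padd P Q)
  then have "P M \<noteq> \<zero> \<or> Q M \<noteq> \<zero>" by (auto simp: indexed_padd_def)
  then show ?case using indexed_padd.IH by blast
next
  case (indexed_pmult P i)
  then have "i \<in># M" "P (M - {#i#}) \<noteq> \<zero>" by (auto simp: indexed_pmult_def split: if_splits)
  then have "set_mset (M - {#i#}) \<subseteq> I" "M = add_mset i (M - {#i#})" using indexed_pmult by auto
  then show ?case using indexed_pmult(2) by (metis insert_subset set_mset_add_mset_insert)
qed

end

text \<open>The definitions of the statement are for records without extra fields.\<close>

locale plain_field = field R for R :: "'a ring" (structure)
begin

lemma indexed_poly_eval_monomials: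
  assumes "finite I" "\<And>M. f M \<in> carrier R" "\<And>M. f M \<noteq> \<zero> \<Longrightarrow> M \<in> monomials I k" "z \<in> I \<rightarrow> carrier R"
  shows "indexed_poly_eval R f z = (\<Oplus>M\<in>monomials I k. f M \<otimes> monomial_at M z)"
  unfolding indexed_poly_eval_def monomial_at_def[symmetric]
  using assms monomial_at_monomials_closed[OF _ assms(4), of _ k]
  by (intro finsum_neutral_superset finite_monomials) auto

text \<open>The tightness part finds its polynomial as a function, while an algebraic graph asks for
  an indexed polynomial. Cutting the coefficients off outside \<open>monomials I k\<close> gives
  finite support, hence membership in \<open>indexed_pset\<close>.\<close>

lemma poly_funs_imp_indexed_poly:
  assumes "finite I" "h \<in> poly_funs I k"
  obtains f where "f \<in> indexed_pset I (carrier R)" "total_degree_le R f k"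
    "\<And>z. z \<in> I \<rightarrow> carrier R \<Longrightarrow> indexed_poly_eval R f z = h z"
proof -
  obtain c where c: "c \<in> UNIV \<rightarrow> carrier R"
    "\<And>z. z \<in> I \<rightarrow> carrier R \<Longrightarrow> h z = (\<Oplus>M\<in>monomials I k. c M \<otimes> monomial_at M z)"
    using assms(2) unfolding poly_funs_def by blast
  have cl: "c M \<in> carrier R" for M using c(1) by auto
  define f where "f = (\<lambda>M. if M \<in> monomials I k then c M else \<zero>)"
  show ?thesis
  proof
    show "f \<in> indexed_pset I (carrier R)"
      unfolding f_def using assms(1) c(1)
      by (intro indexed_pset_of_coeffs finite_monomials) (auto simp: monomials_def)
    show "total_degree_le R f k" by (auto simp: total_degree_le_def f_def monomials_def)
    fix z assume z: "z \<in> I \<rightarrow> carrier R"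
    have "indexed_poly_eval R f z = (\<Oplus>M\<in>monomials I k. f M \<otimes> monomial_at M z)"
      using assms(1) z cl by (intro indexed_poly_eval_monomials) (auto simp: f_def split: if_splits)
    also have "\<dots> = h z"
      unfolding c(2)[OF z] using cl monomial_at_monomials_closed[OF _ z, of _ k]
      by (intro finsum_cong') (auto simp: f_def)
    finally show "indexed_poly_eval R f z = h z" .
  qed
qed

text \<open>Needed because \<open>case_sum x y\<close> is \<open>undefined\<close> beyond the
  coordinates of the two spaces, so it can be compared with other representatives of the same point
  only on the variables in \<open>I\<close>.\<close>

lemma indexed_poly_eval_cong:
  assumes "finite I" "f \<in> indexed_pset I (carrier R)" "total_degree_le R f k"
    "z \<in> I \<rightarrow> carrier R" "\<And>v. v \<in> I \<Longrightarrow> w v = z v"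
  shows "indexed_poly_eval R f w = indexed_poly_eval R f z"
proof -
  have M: "M \<in> monomials I k" if "f M \<noteq> \<zero>" for M
    using that assms(3) indexed_pset_support[OF assms(2)] by (auto simp: monomials_def total_degree_le_def)
  have f: "f M \<in> carrier R" for M
    using indexed_pset_in_carrier[OF _ assms(2)] carrier_coeffE by blast
  have "w \<in> I \<rightarrow> carrier R" using assms(4,5) by auto
  then show ?thesis
    using monomial_at_monomials_closed[OF _ assms(4), of _ k] f assms M
    by (subst (1 2) indexed_poly_eval_monomials[of I _ k])
      (auto intro!: finsum_cong' arg_cong2[where f = "(\<otimes>)"] monomial_at_cong simp: monomials_def Pi_iff subset_iff)
qed

text \<open>Fixing the coordinates outside \<open>J\<close> moves that part of every monomial into
  the coefficient. In this way a point of one part turns each defining polynomial into a polynomial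
  on the space of the other part, of no larger degree.\<close>

lemma indexed_poly_eval_override_poly_funs:
  assumes "finite I" "J \<subseteq> I" "f \<in> indexed_pset I (carrier R)" "total_degree_le R f k" "w \<in> I \<rightarrow> carrier R"
  shows "(\<lambda>z. indexed_poly_eval R f (override_on w z J)) \<in> poly_funs J k"
proof -
  have M: "M \<in> monomials I k" if "f M \<noteq> \<zero>" for M
    using that assms(4) indexed_pset_support[OF assms(3)] by (auto simp: monomials_def total_degree_le_def)
  have f: "f M \<in> carrier R" for M
    using indexed_pset_in_carrier[OF _ assms(3)] carrier_coeffE by blast
  let ?in = "\<lambda>M. filter_mset (\<lambda>v. v \<in> J) M" and ?out = "\<lambda>M. filter_mset (\<lambda>v. v \<notin> J) M"
  have fin: "finite J" using assms(1,2) finite_subset by blast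
  have outcl: "monomial_at (?out M) w \<in> carrier R" if "M \<in> monomials I k" for M
    using that assms(5) by (intro monomial_at_closed) (auto simp: monomials_def)
  have "(\<lambda>z. \<Oplus>M\<in>monomials I k. (f M \<otimes> monomial_at (?out M) w) \<otimes> monomial_at (?in M) z) \<in> poly_funs J k"
  proof (intro poly_funs_finsum finite_monomials poly_funs_monomial fin assms(1))
    fix M assume "M \<in> monomials I k"
    then show "?in M \<in> monomials J k" "f M \<otimes> monomial_at (?out M) w \<in> carrier R"
      using f outcl order_trans[OF size_filter_mset_lesseq[of "\<lambda>v. v \<in> J" M]] by (auto simp: monomials_def)
  qed
  then show ?thesis
  proof (rule poly_funs_cong)
    fix z assume z: "z \<in> J \<rightarrow> carrier R"
    let ?u = "override_on w z J"
    have u: "?u \<in> I \<rightarrow> carrier R" using z assms(5) by (auto simp: override_on_def)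
    have "indexed_poly_eval R f ?u = (\<Oplus>M\<in>monomials I k. f M \<otimes> monomial_at M ?u)"
      using assms(1) f M u by (intro indexed_poly_eval_monomials) auto
    also have "\<dots> = (\<Oplus>M\<in>monomials I k. (f M \<otimes> monomial_at (?out M) w) \<otimes> monomial_at (?in M) z)"
    proof (rule finsum_cong')
      fix M assume M: "M \<in> monomials I k"
      have incl: "monomial_at (?in M) z \<in> carrier R" using z by (intro monomial_at_closed) auto
      have "monomial_at M ?u = monomial_at (?in M) ?u \<otimes> monomial_at (?out M) ?u"
        using monomial_at_add[of ?u "?in M" "?out M"] u M
        by (auto simp: monomials_def subset_iff Pi_iff)
      also have "monomial_at (?in M) ?u = monomial_at (?in M) z"
        using z by (intro monomial_at_cong) auto
      also have "monomial_at (?out M) ?u = monomial_at (?out M) w"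
        using assms(5) M by (intro monomial_at_cong) (auto simp: monomials_def)
      finally show "f M \<otimes> monomial_at M ?u = (f M \<otimes> monomial_at (?out M) w) \<otimes> monomial_at (?in M) z"
        using f incl outcl[OF M] by (simp add: m_ac)
    qed (use f outcl monomial_at_closed[of z "?in M" for M] z in \<open>auto intro!: m_closed\<close>)
    finally show "indexed_poly_eval R f ?u = (\<Oplus>M\<in>monomials I k. (f M \<otimes> monomial_at (?out M) w) \<otimes> monomial_at (?in M) z)" .
  qed
qed

end

section \<open>Linear independence, zero patterns and interpolation over a field\<close>

context field
begin

lemma finprod_eq_zero_iff:
  assumes "finite A" "\<And>i. i \<in> A \<Longrightarrow> f i \<in> carrier R"
  shows "(\<Otimes>i\<in>A. f i) = \<zero> \<longleftrightarrow> (\<exists>i\<in>A. f i = \<zero>)"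
  using assms
proof (induction A)
  case (insert i A)
  then have "f \<in> A \<rightarrow> carrier R" "f i \<in> carrier R" by auto
  then show ?case using insert integral_iff by simp
qed simp

text \<open>Gaussian elimination by induction on the equations \<open>b\<close>, with the elements
  of \<open>L\<close> as unknowns. If some \<open>c p b\<close> is nonzero, the unknown
  \<open>p\<close> is eliminated from the remaining equations and recovered from equation
  \<open>b\<close>.\<close>

lemma linear_dependence:
  assumes "finite B" "finite L" "card B < card L" "\<And>l b. l \<in> L \<Longrightarrow> b \<in> B \<Longrightarrow> c l b \<in> carrier R"
  shows "\<exists>x. (\<forall>l\<in>L. x l \<in> carrier R) \<and> (\<exists>l\<in>L. x l \<noteq> \<zero>) \<and> (\<forall>b\<in>B. (\<Oplus>l\<in>L. c l b \<otimes> x l) = \<zero>)"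
  using assms
proof (induction B arbitrary: L c)
  case empty
  then have "L \<noteq> {}" by auto
  then show ?case by (intro exI[of _ "\<lambda>_. \<one>"]) auto
next
  case (insert b B)
  show ?case
  proof (cases "\<forall>l\<in>L. c l b = \<zero>")
    case True
    obtain x where "\<forall>l\<in>L. x l \<in> carrier R" "\<exists>l\<in>L. x l \<noteq> \<zero>" "\<forall>b\<in>B. (\<Oplus>l\<in>L. c l b \<otimes> x l) = \<zero>"
      using insert.IH[of L c] insert.prems insert.hyps by auto
    moreover from this True have "(\<Oplus>l\<in>L. c l b \<otimes> x l) = \<zero>"
      by (intro add.finprod_one_eqI) auto
    ultimately show ?thesis by (intro exI[of _ x]) auto
  next
    case False
    then obtain p where p: "p \<in> L" "c p b \<noteq> \<zero>" by blast
    define L' where "L' = L - {p}"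
    \<comment> \<open>The multiple of equation \<open>b\<close> whose subtraction from equation
      \<open>b'\<close> cancels the unknown \<open>p\<close>.\<close>
    define e where "e b' = c p b' \<otimes> inv (c p b)" for b'
    have L': "finite L'" "card B < card L'" "p \<notin> L'" "L = insert p L'"
      using insert.prems insert.hyps p unfolding L'_def by auto
    have c: "c l b' \<in> carrier R" if "l \<in> L" "b' \<in> insert b B" for l b' using insert.prems that by blast
    have pcl: "c p b \<in> carrier R" "inv (c p b) \<in> carrier R" "c p b \<otimes> inv (c p b) = \<one>"
      using c p field_Units by auto
    have e: "e b' \<in> carrier R" if "b' \<in> insert b B" for b'
      using c[OF p(1)] that pcl unfolding e_def by auto
    obtain x where x: "\<forall>l\<in>L'. x l \<in> carrier R" "\<exists>l\<in>L'. x l \<noteq> \<zero>"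
      "\<forall>b'\<in>B. (\<Oplus>l\<in>L'. (c l b' \<oplus> \<ominus> e b' \<otimes> c l b) \<otimes> x l) = \<zero>"
      using insert.IH[of L' "\<lambda>l b'. c l b' \<oplus> \<ominus> e b' \<otimes> c l b"] L' c e by auto
    define S where "S b' = (\<Oplus>l\<in>L'. c l b' \<otimes> x l)" for b'
    have S: "S b' \<in> carrier R" if "b' \<in> insert b B" for b'
      using that x c L' unfolding S_def by (intro finsum_closed) auto
    define y where "y = x(p := \<ominus> (inv (c p b) \<otimes> S b))"
    have expand: "(\<Oplus>l\<in>L. c l b' \<otimes> y l) = \<ominus> (e b' \<otimes> S b) \<oplus> S b'" if b': "b' \<in> insert b B" for b'
    proof -
      have "(\<Oplus>l\<in>L. c l b' \<otimes> y l) = c p b' \<otimes> y p \<oplus> (\<Oplus>l\<in>L'. c l b' \<otimes> y l)"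
        unfolding L'(4) using L' c b' x pcl S by (intro finsum_insert) (auto simp: y_def)
      also have "(\<Oplus>l\<in>L'. c l b' \<otimes> y l) = S b'"
        unfolding S_def using L' c b' x by (intro finsum_cong') (auto simp: y_def)
      also have "c p b' \<otimes> y p = \<ominus> (e b' \<otimes> S b)"
        unfolding y_def e_def using pcl S c[OF p(1) b'] by (simp add: r_minus m_assoc)
      finally show ?thesis .
    qed
    have eS: "S b' = e b' \<otimes> S b" if b': "b' \<in> insert b B" for b'
    proof (cases "b' = b")
      case True
      then show ?thesis using pcl S by (simp add: e_def)
    next
      case False
      then have B: "b' \<in> B" using b' by simp
      have cl: "c l b \<in> carrier R" "c l b' \<in> carrier R" "x l \<in> carrier R" if "l \<in> L'" for l
        using that L' c b' x by auto
      have "\<zero> = (\<Oplus>l\<in>L'. (c l b' \<oplus> \<ominus> e b' \<otimes> c l b) \<otimes> x l)" using x(3) B by simp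
      also have "\<dots> = (\<Oplus>l\<in>L'. c l b' \<otimes> x l \<oplus> (\<ominus> e b') \<otimes> (c l b \<otimes> x l))"
        using cl e[OF b'] by (intro finsum_cong') (auto simp: l_distr m_assoc)
      also have "\<dots> = S b' \<oplus> (\<Oplus>l\<in>L'. (\<ominus> e b') \<otimes> (c l b \<otimes> x l))"
        unfolding S_def using cl e[OF b'] by (intro finsum_addf) auto
      also have "(\<Oplus>l\<in>L'. (\<ominus> e b') \<otimes> (c l b \<otimes> x l)) = (\<ominus> e b') \<otimes> S b"
        unfolding S_def using cl e[OF b'] L' by (intro finsum_rdistr[symmetric]) auto
      finally have "S b' \<oplus> \<ominus> (e b' \<otimes> S b) = \<zero>"
        using S e b' by (simp add: l_minus)
      then show ?thesis
        using S e b' r_right_minus_eq[of "S b'" "e b' \<otimes> S b"] by (simp add: a_minus_def)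
    qed
    have "\<forall>b'\<in>insert b B. (\<Oplus>l\<in>L. c l b' \<otimes> y l) = \<zero>"
    proof
      fix b' assume b': "b' \<in> insert b B"
      have "(\<Oplus>l\<in>L. c l b' \<otimes> y l) = \<ominus> S b' \<oplus> S b'"
        unfolding expand[OF b'] eS[OF b', symmetric] ..
      then show "(\<Oplus>l\<in>L. c l b' \<otimes> y l) = \<zero>" using S[OF b'] by (simp add: l_neg)
    qed
    moreover have "\<forall>l\<in>L. y l \<in> carrier R"
      using x L' pcl S unfolding y_def by auto
    moreover have "\<exists>l\<in>L. y l \<noteq> \<zero>"
      using x(2) L'(3,4) unfolding y_def by (metis fun_upd_other insertI2)
    ultimately show ?thesis by blast
  qed
qed

text \<open>The functions \<open>G l\<close> are linearly independent, so they are no more numerous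
  than the monomials: in a nontrivial relation, evaluation at the point of the index of least rank
  with nonzero coefficient leaves only the diagonal term.\<close>

lemma triangular_card_le:
  fixes rank :: "'l \<Rightarrow> nat"
  assumes "finite I" "finite L"
    and G: "\<And>l. l \<in> L \<Longrightarrow> G l \<in> poly_funs I D"
    and z: "\<And>l. l \<in> L \<Longrightarrow> z l \<in> I \<rightarrow> carrier R"
    and diag: "\<And>l. l \<in> L \<Longrightarrow> G l (z l) \<noteq> \<zero>"
    and tri: "\<And>l l'. l \<in> L \<Longrightarrow> l' \<in> L \<Longrightarrow> l \<noteq> l' \<Longrightarrow> rank l' \<le> rank l \<Longrightarrow> G l (z l') = \<zero>"
  shows "card L \<le> card (monomials I D)"
proof (rule ccontr)
  assume "\<not> ?thesis"
  then have less: "card (monomials I D) < card L" by simp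
  have "\<forall>l\<in>L. \<exists>c. c \<in> UNIV \<rightarrow> carrier R \<and>
    (\<forall>z\<in>I \<rightarrow> carrier R. G l z = (\<Oplus>M\<in>monomials I D. c M \<otimes> monomial_at M z))"
    using G unfolding poly_funs_def by blast
  then obtain c where "\<forall>l\<in>L. c l \<in> UNIV \<rightarrow> carrier R \<and>
    (\<forall>z\<in>I \<rightarrow> carrier R. G l z = (\<Oplus>M\<in>monomials I D. c l M \<otimes> monomial_at M z))"
    unfolding bchoice_iff by blast
  then have c: "\<And>l. l \<in> L \<Longrightarrow> c l \<in> UNIV \<rightarrow> carrier R"
    "\<And>l z. l \<in> L \<Longrightarrow> z \<in> I \<rightarrow> carrier R \<Longrightarrow> G l z = (\<Oplus>M\<in>monomials I D. c l M \<otimes> monomial_at M z)"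
    by blast+
  have cl: "c l M \<in> carrier R" if "l \<in> L" for l M using c(1)[OF that] by auto
  obtain x where x: "\<And>l. l \<in> L \<Longrightarrow> x l \<in> carrier R" "\<exists>l\<in>L. x l \<noteq> \<zero>"
    "\<And>M. M \<in> monomials I D \<Longrightarrow> (\<Oplus>l\<in>L. c l M \<otimes> x l) = \<zero>"
    using linear_dependence[OF finite_monomials[OF assms(1)] assms(2) less, of c] cl by blast
  \<comment> \<open>Interchange of the two sums, by induction on \<open>F\<close>. It turns the
    relation between the coefficient vectors into a relation between the values at every point
    \<open>w\<close>.\<close>
  have swap: "(\<Oplus>l\<in>F. G l w \<otimes> x l) = (\<Oplus>M\<in>monomials I D. (\<Oplus>l\<in>F. c l M \<otimes> x l) \<otimes> monomial_at M w)"
    if "finite F" "F \<subseteq> L" and w: "w \<in> I \<rightarrow> carrier R" for F w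
    using that(1,2)
  proof (induction F)
    case empty
    then show ?case
      using monomial_at_monomials_closed[OF _ w, of _ D] by (auto intro!: add.finprod_one_eqI[symmetric])
  next
    case (insert l F)
    note m = monomial_at_monomials_closed[OF _ w, of _ D]
    have l: "l \<in> L" and F: "F \<subseteq> L" using insert.prems by auto
    have Fcl: "(\<Oplus>l\<in>F. c l M \<otimes> x l) \<in> carrier R" for M
      using F cl x by (intro finsum_closed) auto
    have Gcl: "G l' w \<in> carrier R" if "l' \<in> L" for l' using poly_funs_closed[OF G[OF that] w] .
    have "G l w \<otimes> x l = (\<Oplus>M\<in>monomials I D. c l M \<otimes> monomial_at M w \<otimes> x l)"
      unfolding c(2)[OF l w] using m cl[OF l] x(1)[OF l] finite_monomials[OF assms(1)]
      by (intro finsum_ldistr) auto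
    also have "\<dots> = (\<Oplus>M\<in>monomials I D. (c l M \<otimes> x l) \<otimes> monomial_at M w)"
      using m cl[OF l] x(1)[OF l] by (intro finsum_cong') (auto simp: m_ac)
    finally have step: "G l w \<otimes> x l = (\<Oplus>M\<in>monomials I D. (c l M \<otimes> x l) \<otimes> monomial_at M w)" .
    have "(\<Oplus>l\<in>insert l F. G l w \<otimes> x l) = G l w \<otimes> x l \<oplus> (\<Oplus>l\<in>F. G l w \<otimes> x l)"
      using insert.hyps F l x(1) Gcl by (intro finsum_insert) auto
    also have "\<dots> = (\<Oplus>M\<in>monomials I D. (c l M \<otimes> x l) \<otimes> monomial_at M w) \<oplus>
      (\<Oplus>M\<in>monomials I D. (\<Oplus>l\<in>F. c l M \<otimes> x l) \<otimes> monomial_at M w)"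
      unfolding step using insert.IH F by simp
    also have "\<dots> = (\<Oplus>M\<in>monomials I D. (c l M \<otimes> x l) \<otimes> monomial_at M w \<oplus> (\<Oplus>l\<in>F. c l M \<otimes> x l) \<otimes> monomial_at M w)"
      using m cl[OF l] x(1)[OF l] Fcl by (intro finsum_addf[symmetric]) auto
    also have "\<dots> = (\<Oplus>M\<in>monomials I D. (\<Oplus>l\<in>insert l F. c l M \<otimes> x l) \<otimes> monomial_at M w)"
    proof (rule finsum_cong')
      fix M assume M: "M \<in> monomials I D"
      have "(\<Oplus>l\<in>insert l F. c l M \<otimes> x l) = c l M \<otimes> x l \<oplus> (\<Oplus>l\<in>F. c l M \<otimes> x l)"
        using insert.hyps F l x(1) cl by (intro finsum_insert) auto
      then show "(c l M \<otimes> x l) \<otimes> monomial_at M w \<oplus> (\<Oplus>l\<in>F. c l M \<otimes> x l) \<otimes> monomial_at M w =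
        (\<Oplus>l\<in>insert l F. c l M \<otimes> x l) \<otimes> monomial_at M w"
        using m[OF M] cl[OF l] x(1)[OF l] Fcl by (simp add: l_distr)
    qed (use m insert.prems cl x in \<open>auto intro!: m_closed finsum_closed\<close>)
    finally show ?case .
  qed
  have vanish: "(\<Oplus>l\<in>L. G l w \<otimes> x l) = \<zero>" if w: "w \<in> I \<rightarrow> carrier R" for w
    unfolding swap[OF assms(2) order_refl w]
    using x(3) monomial_at_monomials_closed[OF _ w, of _ D] by (intro add.finprod_one_eqI) auto
  define l0 where "l0 = arg_min_on rank {l \<in> L. x l \<noteq> \<zero>}"
  have l0: "l0 \<in> L" "x l0 \<noteq> \<zero>"
    using arg_min_if_finite(1)[of "{l \<in> L. x l \<noteq> \<zero>}" rank] assms(2) x(2) unfolding l0_def by auto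
  have least: "rank l0 \<le> rank l" if "l \<in> L" "x l \<noteq> \<zero>" for l
    using arg_min_least[of "{l \<in> L. x l \<noteq> \<zero>}" l rank] assms(2) that unfolding l0_def by auto
  have Gcl: "G l (z l0) \<in> carrier R" if "l \<in> L" for l
    using poly_funs_closed[OF G[OF that] z[OF l0(1)]] .
  have "(\<Oplus>l\<in>{l0}. G l (z l0) \<otimes> x l) = (\<Oplus>l\<in>L. G l (z l0) \<otimes> x l)"
  proof (rule finsum_neutral_superset)
    fix l assume "l \<in> L - {l0}"
    then show "G l (z l0) \<otimes> x l = \<zero>"
      using tri[of l l0] least[of l] l0 x(1) Gcl by (cases "x l = \<zero>") auto
  qed (use assms(2) l0 x(1) Gcl in auto)
  then have "G l0 (z l0) \<otimes> x l0 = \<zero>"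
    using vanish[OF z[OF l0(1)]] Gcl[OF l0(1)] x(1)[OF l0(1)] by (simp add: finsum_insert)
  then show False
    using diag[OF l0(1)] l0 x(1) Gcl integral_iff by blast
qed

text \<open>The zero pattern theorem of Ronyai, Babai and Ganapathy: the products of the polynomials that
  do not vanish at a witness of each pattern form a triangular system.\<close>

lemma zero_pattern_card_le:
  assumes "finite I" "finite K" "\<And>k. k \<in> K \<Longrightarrow> g k \<in> poly_funs I t" "Z \<subseteq> I \<rightarrow> carrier R"
  shows "card ((\<lambda>z. {k \<in> K. g k z \<noteq> \<zero>}) ` Z) \<le> (t * card K + 1) ^ card I"
proof -
  let ?p = "\<lambda>z. {k \<in> K. g k z \<noteq> \<zero>}"
  define w where "w T = (SOME z. z \<in> Z \<and> ?p z = T)" for T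
  have w: "w T \<in> Z \<and> ?p (w T) = T" if "T \<in> ?p ` Z" for T
    using someI_ex[of "\<lambda>z. z \<in> Z \<and> ?p z = T"] that unfolding w_def by blast
  have L: "finite (?p ` Z)" by (rule finite_subset[of _ "Pow K"]) (use assms(2) in auto)
  have cl: "g k z \<in> carrier R" if "k \<in> K" "z \<in> Z" for k z
    using poly_funs_closed[OF assms(3)] that assms(4) by blast
  have nz: "(\<Otimes>k\<in>T. g k z) \<noteq> \<zero> \<longleftrightarrow> T \<subseteq> ?p z" if "T \<in> ?p ` Z" "z \<in> Z" for T z
  proof -
    have T: "T \<subseteq> K" "finite T" using that assms(2) finite_subset[of _ K] by auto
    then show ?thesis using finprod_eq_zero_iff[of T "\<lambda>k. g k z"] cl that by blast
  qed
  have "card (?p ` Z) \<le> card (monomials I (t * card K))"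
  proof (rule triangular_card_le[where G = "\<lambda>T z. \<Otimes>k\<in>T. g k z" and z = w and rank = card])
    fix T assume T: "T \<in> ?p ` Z"
    then have TK: "T \<subseteq> K" "finite T" using assms(2) finite_subset[of _ K] by auto
    then have "(\<lambda>z. \<Otimes>k\<in>T. g k z) \<in> poly_funs I (t * card T)"
      using assms by (intro poly_funs_finprod) auto
    moreover have "t * card T \<le> t * card K" using TK assms(2) card_mono by auto
    ultimately show "(\<lambda>z. \<Otimes>k\<in>T. g k z) \<in> poly_funs I (t * card K)"
      using poly_funs_mono[OF assms(1)] by blast
    show "w T \<in> I \<rightarrow> carrier R" using w[OF T] assms(4) by blast
    show "(\<Otimes>k\<in>T. g k (w T)) \<noteq> \<zero>" using nz[OF T, of "w T"] w[OF T] by blast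
    fix T' assume T': "T' \<in> ?p ` Z" and "T \<noteq> T'" "card T' \<le> card T"
    moreover have "finite T'" using T' assms(2) finite_subset[of _ K] by auto
    \<comment> \<open>Cardinality serves as the rank: a different pattern that is no larger cannot
      contain \<open>T\<close>, so some factor of the product over \<open>T\<close> vanishes at the
      witness of \<open>T'\<close>.\<close>
    ultimately have "\<not> T \<subseteq> T'" using card_seteq by blast
    then show "(\<Otimes>k\<in>T. g k (w T')) = \<zero>" using nz[OF T, of "w T'"] w[OF T'] by blast
  qed (use assms(1) L in auto)
  then show ?thesis using card_monomials_le[OF assms(1), of "t * card K"] by simp
qed

text \<open>In one variable, more than \<open>t\<close> roots force the zero function. The Newton
  products \<open>G j\<close> at the \<open>t + 1\<close> roots are triangular; a nonzero value
  \<open>h x\<close> would extend them to \<open>t + 2\<close> independent functions in a space of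
  dimension at most \<open>t + 1\<close>.\<close>

lemma poly_funs_singleton_eq_zero:
  assumes "h \<in> poly_funs {v} t" "Z \<subseteq> {v} \<rightarrow> carrier R" "inj_on (\<lambda>z. z v) Z" "finite Z" "card Z = t + 1"
    and zero: "\<And>z. z \<in> Z \<Longrightarrow> h z = \<zero>" and x: "x \<in> {v} \<rightarrow> carrier R"
  shows "h x = \<zero>"
proof (rule ccontr)
  assume hx: "h x \<noteq> \<zero>"
  obtain f where f: "bij_betw f {0..<t + 1} Z"
    using ex_bij_betw_nat_finite[OF assms(4)] assms(5) by auto
  have fZ: "f i \<in> Z" if "i \<le> t" for i using f that by (auto simp: bij_betw_def)
  have fcl: "f i v \<in> carrier R" if "i \<le> t" for i using fZ[OF that] assms(2) by auto
  have fne: "f i v \<noteq> f j v" if "i \<le> t" "j \<le> t" "i \<noteq> j" for i j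
  proof
    assume "f i v = f j v"
    then have "f i = f j" using assms(3) fZ that by (auto simp: inj_on_def)
    then show False using f that by (auto simp: bij_betw_def inj_on_def)
  qed
  define G where "G j = (if j = t + 1 then h else (\<lambda>z. \<Otimes>i\<in>{..<j}. z v \<ominus> f i v))" for j
  define z where "z j = (if j = t + 1 then x else f j)" for j
  have "card {..t + 1} \<le> card (monomials {v} t)"
  proof (rule triangular_card_le[where G = G and z = z and rank = id])
    fix j assume j: "j \<in> {..t + 1}"
    show "z j \<in> {v} \<rightarrow> carrier R" using x fcl j by (auto simp: z_def)
    show "G j \<in> poly_funs {v} t"
    proof (cases "j = t + 1")
      case False
      then have "(\<lambda>z. \<Otimes>i\<in>{..<j}. z v \<oplus> \<ominus> f i v) \<in> poly_funs {v} (1 * card {..<j})"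
        using j fcl by (intro poly_funs_finprod poly_funs_add poly_funs_coord poly_funs_const) auto
      then have "(\<lambda>z. \<Otimes>i\<in>{..<j}. z v \<oplus> \<ominus> f i v) \<in> poly_funs {v} t"
        using False j by (auto intro: poly_funs_mono)
      then show ?thesis using False by (simp add: G_def a_minus_def)
    qed (use assms(1) in \<open>simp add: G_def\<close>)
    show "G j (z j) \<noteq> \<zero>"
    proof (cases "j = t + 1")
      case False
      have "f j v \<ominus> f i v \<noteq> \<zero>" if "i < j" for i
        using r_right_minus_eq[of "f j v" "f i v"] fcl fne[of j i] that j False by auto
      then show ?thesis
        using j fcl False finprod_eq_zero_iff[of "{..<j}" "\<lambda>i. f j v \<ominus> f i v"]
        by (auto simp: G_def z_def)
    qed (use hx in \<open>simp add: G_def z_def\<close>)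
    fix l assume l: "l \<in> {..t + 1}" "j \<noteq> l" "id l \<le> id j"
    then have l': "l \<le> t" "l < j" using j by auto
    show "G j (z l) = \<zero>"
    proof (cases "j = t + 1")
      case False
      have "f l v \<ominus> f l v = \<zero>" using fcl l' by (simp add: r_neg a_minus_def)
      then show ?thesis
        using j fcl l' False finprod_eq_zero_iff[of "{..<j}" "\<lambda>i. f l v \<ominus> f i v"]
        by (auto simp: G_def z_def)
    qed (use zero fZ l' in \<open>simp add: G_def z_def\<close>)
  qed auto
  then show False using card_monomials_le[of "{v}" t] by simp
qed

text \<open>The sample space for random polynomials. Restriction to \<open>Z\<close> makes it finite
  over a finite field and identifies polynomials with the same values on \<open>Z\<close>;
  probabilities are counts in this set.\<close>

definition restricted_poly_funs :: "'v set \<Rightarrow> nat \<Rightarrow> ('v \<Rightarrow> 'a) set \<Rightarrow> (('v \<Rightarrow> 'a) \<Rightarrow> 'a) set" where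
  "restricted_poly_funs I t Z = (\<lambda>g. restrict g Z) ` poly_funs I t"

lemma finite_restricted_poly_funs:
  assumes "finite (carrier R)" "finite Z" "Z \<subseteq> I \<rightarrow> carrier R"
  shows "finite (restricted_poly_funs I t Z)"
proof (rule finite_subset)
  show "restricted_poly_funs I t Z \<subseteq> Z \<rightarrow>\<^sub>E carrier R"
  proof
    fix h assume "h \<in> restricted_poly_funs I t Z"
    then obtain g where g: "g \<in> poly_funs I t" "h = restrict g Z"
      unfolding restricted_poly_funs_def by blast
    then show "h \<in> Z \<rightarrow>\<^sub>E carrier R"
      using poly_funs_closed[OF g(1)] assms(3) by auto
  qed
qed (use assms in \<open>auto intro: finite_PiE\<close>)

text \<open>This is the \<open>(t + 1)\<close>-wise independence of the values of a random polynomial. Shifting by a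
  polynomial that vanishes at all points of \<open>T\<close> but the last gives the induction step.\<close>

lemma card_vanishing_restricted_poly_funs:
  assumes I: "finite I" and q: "finite (carrier R)" and Z: "finite Z" "Z \<subseteq> I \<rightarrow> carrier R"
    and sep: "\<And>z w. z \<in> Z \<Longrightarrow> w \<in> Z \<Longrightarrow> z \<noteq> w \<Longrightarrow> \<exists>v\<in>I. z v \<noteq> w v"
    and T: "T \<subseteq> Z" "card T \<le> t + 1"
  shows "card (carrier R) ^ card T * card {h \<in> restricted_poly_funs I t Z. \<forall>z\<in>T. h z = \<zero>} =
    card (restricted_poly_funs I t Z)"
proof -
  let ?V = "\<lambda>T. {h \<in> restricted_poly_funs I t Z. \<forall>z\<in>T. h z = \<zero>}"
  have "finite T" using T(1) Z(1) finite_subset by blast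
  then show ?thesis using T
  proof (induction T)
    case empty
    then show ?case by simp
  next
    case (insert x T)
    have x: "x \<in> Z" and TZ: "T \<subseteq> Z" and cT: "card T \<le> t" and xT: "x \<notin> T" using insert by auto
    have "\<forall>w\<in>T. \<exists>v\<in>I. x v \<noteq> w v" using sep x TZ xT by (metis subsetD)
    then obtain v where v: "\<And>w. w \<in> T \<Longrightarrow> v w \<in> I" "\<And>w. w \<in> T \<Longrightarrow> x (v w) \<noteq> w (v w)" by metis
    \<comment> \<open>One linear factor for each point of \<open>T\<close>, in a coordinate where
      that point differs from \<open>x\<close>. The degree \<open>card T\<close> is at most
      \<open>t\<close>, which is where the bound \<open>t + 1\<close> on the number of points
      enters.\<close>
    define u where "u z = (\<Otimes>w\<in>T. z (v w) \<oplus> \<ominus> w (v w))" for z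
    have coord: "z (v w) \<in> carrier R" if "w \<in> T" "z \<in> Z" for w z using that v Z by auto
    have "u \<in> poly_funs I (1 * card T)"
      unfolding u_def using I v(1) insert.hyps coord TZ
      by (intro poly_funs_finprod poly_funs_add poly_funs_coord poly_funs_const) auto
    then have u: "u \<in> poly_funs I t" using cT poly_funs_mono[OF I] by auto
    have ucl: "u z \<in> carrier R" if "z \<in> Z" for z using poly_funs_closed[OF u] that Z by blast
    have uz: "u z = \<zero> \<longleftrightarrow> (\<exists>w\<in>T. z (v w) \<oplus> \<ominus> w (v w) = \<zero>)" if "z \<in> Z" for z
      unfolding u_def using insert.hyps coord that TZ by (intro finprod_eq_zero_iff) auto
    have ux: "u x \<noteq> \<zero>"
    proof
      assume "u x = \<zero>"
      then obtain w where w: "w \<in> T" "x (v w) \<oplus> \<ominus> w (v w) = \<zero>" using uz[OF x] by blast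
      moreover have "w \<in> Z" using w TZ by blast
      ultimately have "x (v w) = w (v w)"
        using coord[OF w(1)] x by (metis a_minus_def r_right_minus_eq)
      then show False using v(2) w by blast
    qed
    have uT: "u z = \<zero>" if "z \<in> T" for z
    proof -
      have "z (v z) \<oplus> \<ominus> z (v z) = \<zero>" using coord that TZ by (intro r_neg) blast
      then show ?thesis using uz that TZ by blast
    qed
    define \<Psi> where "\<Psi> = (\<lambda>(h, a). restrict (\<lambda>z. h z \<oplus> a \<otimes> u z) Z)"
    have hcl: "h z \<in> carrier R" if h: "h \<in> restricted_poly_funs I t Z" "z \<in> Z" for h z
    proof -
      obtain g where "g \<in> poly_funs I t" "h = restrict g Z"
        using h unfolding restricted_poly_funs_def by blast
      then show ?thesis using poly_funs_closed[of g I t z] h Z by auto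
    qed
    have shift: "restrict (\<lambda>z. h z \<oplus> a \<otimes> u z) Z \<in> restricted_poly_funs I t Z"
      if h: "h \<in> restricted_poly_funs I t Z" "a \<in> carrier R" for h a
    proof -
      obtain g where g: "g \<in> poly_funs I t" "h = restrict g Z"
        using h unfolding restricted_poly_funs_def by blast
      have "(\<lambda>z. a \<otimes> u z) \<in> poly_funs I (0 + t)"
        using I u h by (intro poly_funs_mult poly_funs_const) auto
      then have "(\<lambda>z. g z \<oplus> a \<otimes> u z) \<in> poly_funs I t"
        using g by (intro poly_funs_add) auto
      moreover have "restrict (\<lambda>z. h z \<oplus> a \<otimes> u z) Z = restrict (\<lambda>z. g z \<oplus> a \<otimes> u z) Z"
        using g by auto
      ultimately show ?thesis unfolding restricted_poly_funs_def by blast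
    qed
    \<comment> \<open>A function vanishing on \<open>T\<close> is, in exactly one way, a function
      vanishing on \<open>insert x T\<close> plus a multiple of \<open>u\<close>; its value at
      \<open>x\<close> determines the multiple. So each further point divides the count by the order
      of the field.\<close>
    have "bij_betw \<Psi> (?V (insert x T) \<times> carrier R) (?V T)"
      unfolding bij_betw_def
    proof
      show "inj_on \<Psi> (?V (insert x T) \<times> carrier R)"
      proof (rule inj_onI, clarify)
        fix h a h' a'
        assume h: "h \<in> restricted_poly_funs I t Z" "\<forall>z\<in>insert x T. h z = \<zero>" "a \<in> carrier R"
          and h': "h' \<in> restricted_poly_funs I t Z" "\<forall>z\<in>insert x T. h' z = \<zero>" "a' \<in> carrier R"
          and eq: "\<Psi> (h, a) = \<Psi> (h', a')"
        have pt: "h z \<oplus> a \<otimes> u z = h' z \<oplus> a' \<otimes> u z" if "z \<in> Z" for z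
          using fun_cong[OF eq, of z] that by (simp add: \<Psi>_def)
        have "a \<otimes> u x = a' \<otimes> u x" using pt[OF x] h h' ucl[OF x] by simp
        then have a: "a = a'" using ux ucl[OF x] h h' by (simp add: m_rcancel)
        have "h z = h' z" for z
        proof (cases "z \<in> Z")
          case True
          then show ?thesis using pt[OF True] h h' hcl ucl a by simp
        next
          case False
          then show ?thesis using h(1) h'(1) unfolding restricted_poly_funs_def by auto
        qed
        then show "h = h' \<and> a = a'" using a by blast
      qed
      show "\<Psi> ` (?V (insert x T) \<times> carrier R) = ?V T"
      proof (intro subset_antisym subsetI)
        fix k assume "k \<in> \<Psi> ` (?V (insert x T) \<times> carrier R)"
        then obtain h a where ha: "h \<in> ?V (insert x T)" "a \<in> carrier R" "k = \<Psi> (h, a)" by blast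
        have "k z = \<zero>" if "z \<in> T" for z
          using that ha uT TZ by (auto simp: \<Psi>_def)
        then show "k \<in> ?V T" using shift ha by (auto simp: \<Psi>_def)
      next
        fix k assume k: "k \<in> ?V T"
        define a where "a = k x \<otimes> inv (u x)"
        have inv: "inv (u x) \<in> carrier R" "inv (u x) \<otimes> u x = \<one>"
          using ux ucl[OF x] field_Units by auto
        have a: "a \<in> carrier R" "a \<otimes> u x = k x"
          using inv k hcl ucl x by (auto simp: a_def m_assoc)
        define h where "h = restrict (\<lambda>z. k z \<oplus> (\<ominus> a) \<otimes> u z) Z"
        have "h \<in> restricted_poly_funs I t Z" unfolding h_def using shift k a by auto
        moreover have "h x = \<zero>" using x a k hcl ucl by (simp add: h_def l_minus r_neg)
        moreover have "h z = \<zero>" if "z \<in> T" for z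
          using that k TZ a uT by (auto simp: h_def)
        ultimately have hV: "h \<in> ?V (insert x T)" by simp
        have "k z = \<Psi> (h, a) z" for z
        proof (cases "z \<in> Z")
          case True
          have "k z \<in> carrier R" "a \<otimes> u z \<in> carrier R" using k hcl ucl True a by auto
          then show ?thesis using True ucl a by (simp add: \<Psi>_def h_def a_assoc l_minus l_neg)
        next
          case False
          then show ?thesis using k unfolding restricted_poly_funs_def by (auto simp: \<Psi>_def)
        qed
        then show "k \<in> \<Psi> ` (?V (insert x T) \<times> carrier R)" using hV a by blast
      qed
    qed
    from bij_betw_same_card[OF this]
    have "card (?V (insert x T)) * card (carrier R) = card (?V T)"
      by (simp only: card_cartesian_product)
    moreover have "card (carrier R) ^ card T * card (?V T) = card (restricted_poly_funs I t Z)"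
      using insert.IH TZ cT by simp
    moreover have "q ^ card (insert x T) * a = q ^ card T * (a * q)" for q a :: nat
      using insert.hyps by simp
    ultimately show ?case by (simp only:)
  qed
qed

end

section \<open>Relations with few traces\<close>

text \<open>Each step adds the vertex with the most neighbours among those \<open>y\<close> that still have fewer than
  \<open>s\<close> sampled neighbours.\<close>

lemma greedy_sample:
  fixes adj :: "'x \<Rightarrow> 'y \<Rightarrow> bool"
  assumes fin: "finite P" "finite Q"
    and deg: "\<And>y. y \<in> Q \<Longrightarrow> D \<le> card {x \<in> P. adj x y}"
    and D: "2 * s \<le> D" and k: "4 * s * card P < k * D"
  shows "\<exists>S\<subseteq>P. card S \<le> k \<and> 2 * card {y \<in> Q. card {x \<in> S. adj x y} < s} \<le> card Q"
proof -
  define U where "U S = {y \<in> Q. card {x \<in> S. adj x y} < s}" for S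
  define pot where "pot S = (\<Sum>y\<in>Q. min s (card {x \<in> S. adj x y}))" for S
  \<comment> \<open>As long as more than half of \<open>Q\<close> is short of \<open>s\<close>
    sampled neighbours, a step raises the potential by at least
    \<open>card Q * D / (4 * card P)\<close>. The cap \<open>s * card Q\<close> on the potential is
    then exceeded after \<open>k\<close> steps.\<close>
  have "\<exists>S\<subseteq>P. card S \<le> j \<and> (2 * card (U S) \<le> card Q \<or> j * (card Q * D) \<le> 4 * card P * pot S)" for j
  proof (induction j)
    case 0
    then show ?case by (intro exI[of _ "{}"]) auto
  next
    case (Suc j)
    then obtain S where S: "S \<subseteq> P" "card S \<le> j"
      "2 * card (U S) \<le> card Q \<or> j * (card Q * D) \<le> 4 * card P * pot S" by blast
    show ?case
    proof (cases "2 * card (U S) \<le> card Q")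
      case True
      then show ?thesis using S by (intro exI[of _ S]) auto
    next
      case False
      have fS: "finite S" using S fin finite_subset by blast
      have fU: "finite (U S)" using fin by (simp add: U_def)
      define f where "f x = card {y \<in> U S. adj x y}" for x
      have count: "(\<Sum>x\<in>P - S. f x) = (\<Sum>y\<in>U S. card {x \<in> P - S. adj x y})"
        unfolding f_def using fin fU by (intro sum_multicount_gen) auto
      \<comment> \<open>Fewer than \<open>s\<close> of the at least \<open>2 * s\<close> neighbours
        have been sampled, so at least half of \<open>D\<close> remain available.\<close>
      have "D \<le> 2 * card {x \<in> P - S. adj x y}" if y: "y \<in> U S" for y
      proof -
        have "card {x \<in> P. adj x y} \<le> card {x \<in> P - S. adj x y} + card {x \<in> S. adj x y}"
          using card_Un_le[of "{x \<in> P - S. adj x y}" "{x \<in> S. adj x y}"] fin fS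
            card_mono[of "{x \<in> P - S. adj x y} \<union> {x \<in> S. adj x y}" "{x \<in> P. adj x y}"] by force
        then show ?thesis using deg[of y] y D unfolding U_def by auto
      qed
      then have "(\<Sum>y\<in>U S. D) \<le> (\<Sum>y\<in>U S. 2 * card {x \<in> P - S. adj x y})" by (intro sum_mono) auto
      then have "card (U S) * D \<le> 2 * (\<Sum>x\<in>P - S. f x)"
        by (simp add: count sum_distrib_left)
      moreover have "card Q * D \<le> (2 * card (U S)) * D" using False by (intro mult_right_mono) auto
      ultimately have f_sum: "card Q * D \<le> 4 * (\<Sum>x\<in>P - S. f x)" by linarith
      have QD: "card Q * D > 0"
      proof -
        have "U S \<noteq> {}" using False by auto
        then have "s > 0" "Q \<noteq> {}" unfolding U_def by auto
        then show ?thesis using D fin by (simp add: card_gt_0_iff)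
      qed
      have "\<exists>x\<in>P - S. card Q * D \<le> 4 * card P * f x"
      proof (rule ccontr)
        assume "\<not> ?thesis"
        then have *: "4 * card P * f x < card Q * D" if "x \<in> P - S" for x using that by (meson not_le)
        have ne: "P - S \<noteq> {}" using f_sum QD by (metis mult_0_right not_le sum.empty)
        have "card P * (card Q * D) \<le> (\<Sum>x\<in>P - S. 4 * card P * f x)"
          using mult_left_mono[OF f_sum, of "card P"] by (simp add: sum_distrib_left mult_ac)
        also have "\<dots> < (\<Sum>x\<in>P - S. card Q * D)"
          using * ne fin by (intro sum_strict_mono) auto
        also have "\<dots> \<le> card P * (card Q * D)"
          using fin by (simp add: card_mono mult_right_mono)
        finally show False by simp
      qed
      then obtain x where x: "x \<in> P - S" "card Q * D \<le> 4 * card P * f x" by blast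
      have "pot S + f x = (\<Sum>y\<in>Q. min s (card {x \<in> S. adj x y}) + (if y \<in> U S \<and> adj x y then 1 else 0))"
      proof -
        have "f x = (\<Sum>y\<in>Q. if y \<in> U S \<and> adj x y then 1 else 0)"
          unfolding f_def using fin by (subst sum.If_cases) (auto simp: U_def intro: arg_cong[where f = card])
        then show ?thesis unfolding pot_def by (simp add: sum.distrib)
      qed
      also have "\<dots> \<le> pot (insert x S)"
        unfolding pot_def
      proof (rule sum_mono)
        fix y assume y: "y \<in> Q"
        have "card {x' \<in> insert x S. adj x' y} = card {x' \<in> S. adj x' y} + (if adj x y then 1 else 0)"
        proof (cases "adj x y")
          case True
          then have "{x' \<in> insert x S. adj x' y} = insert x {x' \<in> S. adj x' y}" by auto
          then show ?thesis using x fS True by simp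
        next
          case False
          then have "{x' \<in> insert x S. adj x' y} = {x' \<in> S. adj x' y}" by auto
          then show ?thesis using False by simp
        qed
        then show "min s (card {x \<in> S. adj x y}) + (if y \<in> U S \<and> adj x y then 1 else 0) \<le>
          min s (card {x' \<in> insert x S. adj x' y})"
          unfolding U_def by auto
      qed
      finally have "4 * card P * (pot S + f x) \<le> 4 * card P * pot (insert x S)" by simp
      moreover have "Suc j * (card Q * D) \<le> 4 * card P * (pot S + f x)"
        using S(3) False x(2) by (simp add: distrib_left)
      ultimately have "Suc j * (card Q * D) \<le> 4 * card P * pot (insert x S)" by (rule order_trans[rotated])
      moreover have "card (insert x S) \<le> Suc j" using S(2) fS by (simp add: card_insert_if)
      ultimately show ?thesis using S(1) x(1) by (intro exI[of _ "insert x S"]) auto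
    qed
  qed
  from this[of k] obtain S where S: "S \<subseteq> P" "card S \<le> k"
    "2 * card (U S) \<le> card Q \<or> k * (card Q * D) \<le> 4 * card P * pot S" by blast
  have "2 * card (U S) \<le> card Q"
  proof (rule ccontr)
    assume not: "\<not> ?thesis"
    then have "card Q > 0"
      using card_mono[of Q "U S"] fin unfolding U_def by (cases "card Q = 0") auto
    then have "4 * card P * s * card Q < k * D * card Q" using k by (simp add: mult_ac)
    also have "\<dots> \<le> 4 * card P * pot S" using S(3) not by (simp add: mult_ac)
    also have "pot S \<le> s * card Q"
      unfolding pot_def using sum_bounded_above[of Q "\<lambda>y. min s (card {x \<in> S. adj x y})" s] by (simp add: mult_ac)
    finally show False by (simp add: mult_ac)
  qed
  then show ?thesis using S unfolding U_def by blast
qed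

text \<open>The summand \<open>32 * s^2 * (a + 1)\<close> is the factor of the main term when the
  sample size is at least half of \<open>r / (4 * s * (a + 1))\<close>, with \<open>r\<close> the
  root of the number of vertices; \<open>2 * s + 1\<close> pays for rounding and for the requirement
  \<open>2 * s \<le> D\<close>.\<close>

definition deg_const :: "nat \<Rightarrow> nat \<Rightarrow> real" where
  "deg_const a s = 32 * real s ^ 2 * (real a + 1) + 2 * real s + 1"

text \<open>Nothing algebraic remains except the polynomial bound in \<open>traces\<close>. The set
  \<open>Q0\<close> stays fixed, so that the assumptions apply unchanged to every subset
  \<open>Q\<close> met while vertices are deleted.\<close>

locale sparse_relation =
  fixes P :: "'x set" and adj :: "'x \<Rightarrow> 'y \<Rightarrow> bool" and Q0 :: "'y set" and a d s :: nat
  assumes fin: "finite P" "finite Q0"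
    and free: "\<And>A B. A \<subseteq> P \<Longrightarrow> B \<subseteq> Q0 \<Longrightarrow> card A = s \<Longrightarrow> card B = s \<Longrightarrow> \<exists>x\<in>A. \<exists>y\<in>B. \<not> adj x y"
    and traces: "\<And>S. S \<subseteq> P \<Longrightarrow> card ((\<lambda>y. {x \<in> S. adj x y}) ` Q0) \<le> (a * card S + 1) ^ d"
begin

text \<open>Vertices with the same trace on a sample that contains at least \<open>s\<close> of their neighbours are
  fewer than \<open>s\<close>.\<close>

lemma ex_degree_less:
  assumes Q: "Q \<subseteq> Q0" "2 * s * (a * k + 1) ^ d < card Q"
    and k: "4 * s * card P < k * D" and D: "2 * s \<le> D"
  shows "\<exists>y\<in>Q. card {x \<in> P. adj x y} < D"
proof (rule ccontr)
  assume "\<not> ?thesis"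
  then have deg: "D \<le> card {x \<in> P. adj x y}" if "y \<in> Q" for y using that by force
  have fQ: "finite Q" using Q fin finite_subset by blast
  obtain S where S: "S \<subseteq> P" "card S \<le> k" "2 * card {y \<in> Q. card {x \<in> S. adj x y} < s} \<le> card Q"
    using greedy_sample[of P Q D adj s k] fin(1) fQ deg D k by blast
  define W where "W = {y \<in> Q. s \<le> card {x \<in> S. adj x y}}"
  let ?tr = "\<lambda>y. {x \<in> S. adj x y}"
  have fW: "finite W" using fQ by (simp add: W_def)
  have "Q = {y \<in> Q. card {x \<in> S. adj x y} < s} \<union> W" unfolding W_def by auto
  then have "card Q \<le> card {y \<in> Q. card {x \<in> S. adj x y} < s} + card W" by (metis card_Un_le)
  then have W: "card Q \<le> 2 * card W" using S(3) by simp
  have small: "card {y \<in> W. ?tr y = \<tau>} \<le> s" if \<tau>: "\<tau> \<in> ?tr ` W" for \<tau>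
  proof (rule ccontr)
    assume "\<not> ?thesis"
    then have "s \<le> card {y \<in> W. ?tr y = \<tau>}" by simp
    from obtain_subset_with_card_n[OF this]
    obtain B where B: "B \<subseteq> {y \<in> W. ?tr y = \<tau>}" "card B = s" by blast
    obtain y where "y \<in> W" "\<tau> = ?tr y" using \<tau> by blast
    then have "s \<le> card \<tau>" by (simp add: W_def)
    from obtain_subset_with_card_n[OF this] obtain A where A: "A \<subseteq> \<tau>" "card A = s" by blast
    have "A \<subseteq> P" using A \<tau> S by auto
    moreover have "B \<subseteq> Q0" using B Q by (auto simp: W_def)
    moreover have "adj x y" if "x \<in> A" "y \<in> B" for x y using that A B by blast
    ultimately show False using free[of A B] A B by blast
  qed
  have "card W = card (\<Union>\<tau>\<in>?tr ` W. {y \<in> W. ?tr y = \<tau>})" by (rule arg_cong[where f = card]) auto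
  also have "\<dots> \<le> (\<Sum>\<tau>\<in>?tr ` W. card {y \<in> W. ?tr y = \<tau>})"
    using fW by (intro card_UN_le) auto
  also have "\<dots> \<le> card (?tr ` W) * s" using sum_bounded_above[OF small] by simp
  also have "card (?tr ` W) \<le> card (?tr ` Q0)"
    using Q fin by (intro card_mono) (auto simp: W_def)
  also have "\<dots> \<le> (a * card S + 1) ^ d" using traces S by blast
  also have "\<dots> \<le> (a * k + 1) ^ d" using S(2) by (intro power_mono) auto
  finally have "2 * card W \<le> 2 * s * (a * k + 1) ^ d" by (simp add: mult.commute)
  then show False using W Q by simp
qed

text \<open>The sampling lemma with the largest sample that keeps the number of traces small
  compared with \<open>card Q\<close>; the degree threshold is then of order
  \<open>card P / k\<close>.\<close>

lemma ex_small_degree: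
  assumes Q: "Q \<subseteq> Q0" "Q \<noteq> {}" and s: "s \<ge> 1" and d: "d \<ge> 1"
  shows "\<exists>y\<in>Q. real (card {x \<in> P. adj x y}) \<le>
    deg_const a s * (real (card P) * real (card Q) powr (- 1 / real d) + 1)"
proof -
  define n where "n = card Q"
  define m where "m = card P"
  define r where "r = real n powr (1 / real d)"
  \<comment> \<open>For positive \<open>k\<close> this makes \<open>a * k + 1\<close> at most
    \<open>r / (4 * s)\<close>. A sample of \<open>k\<close> points then leaves at most
    \<open>n / (4 * s)\<close> traces, half of the limit in \<open>ex_degree_less\<close>.\<close>
  define k where "k = nat \<lfloor>r / (4 * s * (a + 1))\<rfloor>"
  have n: "n > 0" using Q fin finite_subset unfolding n_def by (metis card_gt_0_iff)
  have r: "r > 0" using n by (simp add: r_def)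
  have rd: "r ^ d = n"
    using n d unfolding r_def by (simp add: powr_realpow[symmetric] powr_powr)
  have inv_r: "real n powr (- 1 / real d) = 1 / r"
    unfolding r_def by (simp add: powr_minus_divide)
  show ?thesis
  proof (cases "k = 0")
    \<comment> \<open>Here \<open>r\<close> is bounded by a constant, so the trivial degree bound
      \<open>m\<close> is already of order \<open>m / r\<close>.\<close>
    case True
    obtain y where y: "y \<in> Q" using Q by blast
    have "\<lfloor>r / (4 * s * (a + 1))\<rfloor> < 1" using True by (simp add: k_def)
    then have "r / (4 * s * (a + 1)) < 1" by linarith
    moreover have "real (4 * s * (a + 1)) > 0" using s unfolding of_nat_0_less_iff by simp
    ultimately have "r \<le> 4 * s * (a + 1)" by (simp only: pos_divide_less_eq)
    also have "\<dots> \<le> 32 * real s ^ 2 * (real a + 1)"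
    proof -
      have "real s * 4 \<le> 32 * real s ^ 2" using s by (simp add: power2_eq_square)
      then have "real s * 4 * (real a + 1) \<le> 32 * real s ^ 2 * (real a + 1)" by (intro mult_right_mono) auto
      then show ?thesis by (simp add: algebra_simps)
    qed
    also have "\<dots> \<le> deg_const a s" by (simp add: deg_const_def)
    finally have "1 \<le> deg_const a s * (1 / r)" using r by (simp add: divide_simps)
    then have "real m * 1 \<le> real m * (deg_const a s * (1 / r))" by (intro mult_left_mono) auto
    moreover have "card {x \<in> P. adj x y} \<le> m" unfolding m_def using fin by (intro card_mono) auto
    moreover have "deg_const a s \<ge> 0" by (simp add: deg_const_def)
    ultimately have "real (card {x \<in> P. adj x y}) \<le> deg_const a s * (real m * (1 / r) + 1)"
      by (simp add: algebra_simps)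
    then show ?thesis using y inv_r unfolding m_def n_def by auto
  next
    case False
    define u where "u = r / (4 * s * (a + 1))"
    have k_le: "real k \<le> u" and "u < real k + 1"
      using False unfolding k_def u_def[symmetric] by linarith+
    then have k_ge: "u / 2 \<le> real k" using False by linarith
    have u_eq: "u = r / (4 * real s) / (real a + 1)" by (simp add: u_def algebra_simps)
    have a1: "real a + 1 > 0" by simp
    then have ur: "u * (a + 1) = r / (4 * s)" unfolding u_eq by (simp add: add.commute)
    have u0: "u > 0" unfolding u_eq using r s a1 by (intro divide_pos_pos) auto
    have "real (a * k + 1) \<le> real k * (a + 1)" using False by (simp add: algebra_simps)
    also have "\<dots> \<le> u * (a + 1)" using k_le by (intro mult_right_mono) auto
    finally have "real (a * k + 1) \<le> r / (4 * s)" using ur by simp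
    then have "real (a * k + 1) ^ d \<le> (r / (4 * s)) ^ d" by (intro power_mono) auto
    also have "\<dots> = n / (4 * s) ^ d" by (simp add: power_divide rd)
    also have "\<dots> \<le> n / (4 * s)"
      using s d n self_le_power[of "4 * real s" d] by (intro divide_left_mono) auto
    finally have "2 * s * real (a * k + 1) ^ d \<le> 2 * s * (n / (4 * s))" by (intro mult_left_mono) auto
    also have "\<dots> < n" using s n by simp
    finally have "real (2 * s * (a * k + 1) ^ d) < real n" by simp
    then have kn: "2 * s * (a * k + 1) ^ d < card Q" unfolding n_def by linarith
    define v where "v = 4 * real s * m / k"
    \<comment> \<open>Rounding up past \<open>v\<close> gives \<open>4 * s * m < k * D\<close>, and
      the summand \<open>2 * s\<close> meets the requirement \<open>2 * s \<le> D\<close>; it is the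
      source of the additive constant in the degree bound.\<close>
    define D where "D = nat \<lfloor>v\<rfloor> + 2 * s + 1"
    have v0: "v \<ge> 0" by (simp add: v_def)
    have vD: "v < real D" "real D \<le> v + 2 * s + 1"
      using v0 s unfolding D_def by (simp_all, linarith+)
    have "4 * real s * m < real k * real D" using vD(1) False by (simp add: v_def divide_simps mult_ac split: if_splits)
    then have "real (4 * s * card P) < real (k * D)" by (simp add: m_def)
    then have "4 * s * card P < k * D" by linarith
    then obtain y where y: "y \<in> Q" "card {x \<in> P. adj x y} < D"
      using ex_degree_less[OF Q(1) kn, of D] by (auto simp: D_def)
    have "v \<le> 4 * real s * m / (u / 2)"
      unfolding v_def using k_ge u0 False by (intro divide_left_mono) auto
    also have "\<dots> = 32 * real s ^ 2 * (real a + 1) * (m * (1 / r))"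
      using r s a1 unfolding u_eq by (simp add: power2_eq_square)
    also have "\<dots> \<le> deg_const a s * (m * (1 / r))"
      using r by (intro mult_right_mono) (auto simp: deg_const_def)
    finally have "real D \<le> deg_const a s * (m * (1 / r)) + (2 * s + 1)" using vD by simp
    moreover have "2 * real s + 1 \<le> deg_const a s" by (simp add: deg_const_def)
    ultimately have "real (card {x \<in> P. adj x y}) \<le> deg_const a s * (m * (1 / r) + 1)"
      using y(2) by (simp add: distrib_left)
    then show ?thesis using y inv_r unfolding m_def n_def by auto
  qed
qed

text \<open>Deleting a vertex of small degree from \<open>N\<close> vertices costs a multiple of
  \<open>card P * N powr (- 1 / d) + 1\<close>. These powers sum to at most
  \<open>2 * N powr (1 - 1 / d)\<close> because \<open>1 / d \<le> 1 / 2\<close>; the induction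
  carries this out as a telescoping inequality.\<close>

lemma card_relation_le:
  assumes "Q \<subseteq> Q0" and s: "s \<ge> 1" and d: "d \<ge> 2"
  shows "real (\<Sum>y\<in>Q. card {x \<in> P. adj x y}) \<le>
    deg_const a s * (2 * (real (card P) * real (card Q) powr (1 - 1 / real d)) + real (card Q))"
  using assms(1)
proof (induction "card Q" arbitrary: Q)
  case 0
  then have "Q = {}" using fin finite_subset by (metis card_0_eq)
  then show ?case by simp
next
  case (Suc n)
  define m where "m = real (card P)"
  define N where "N = real (Suc n)"
  have fQ: "finite Q" using Suc.prems fin finite_subset by blast
  have "Q \<noteq> {}" using Suc.hyps by auto
  then obtain y where y: "y \<in> Q" "real (card {x \<in> P. adj x y}) \<le> deg_const a s * (m * N powr (- 1 / real d) + 1)"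
    using ex_small_degree[OF Suc.prems] s d Suc.hyps unfolding m_def N_def by fastforce
  have c: "card (Q - {y}) = n" using y fQ Suc.hyps by simp
  have "real (\<Sum>y\<in>Q - {y}. card {x \<in> P. adj x y}) \<le>
    deg_const a s * (2 * (m * real n powr (1 - 1 / real d)) + real n)"
    using Suc.hyps(1)[of "Q - {y}"] c Suc.prems unfolding m_def by auto
  moreover have "real (\<Sum>y\<in>Q. card {x \<in> P. adj x y}) =
    real (card {x \<in> P. adj x y}) + real (\<Sum>y\<in>Q - {y}. card {x \<in> P. adj x y})"
    using y fQ by (simp add: sum.remove)
  ultimately have "real (\<Sum>y\<in>Q. card {x \<in> P. adj x y}) \<le>
    deg_const a s * (m * N powr (- 1 / real d) + 1 + (2 * (m * real n powr (1 - 1 / real d)) + real n))"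
    using y by (simp add: distrib_left)
  also have "\<dots> \<le> deg_const a s * (2 * (m * N powr (1 - 1 / real d)) + N)"
  proof (rule mult_left_mono)
    have "N powr (- 1 / real d) + 2 * real n powr (1 - 1 / real d) \<le> 2 * N powr (1 - 1 / real d)"
    proof (cases "n = 0")
      case True
      then show ?thesis using d by (simp add: N_def)
    next
      case False
      define b where "b = 1 / real d"
      have b: "0 < b" "b \<le> 1 / 2" using d by (auto simp: b_def field_simps)
      have n: "real n > 0" "N > 0" "N = n + 1" using False by (auto simp: N_def)
      \<comment> \<open>The only use of \<open>b \<le> 1 / 2\<close>. The bound on the square root
        that follows is what makes the factor 2 sufficient.\<close>
      have "(N / n) powr b \<le> (N / n) powr (1 / 2)" using b n by (intro powr_mono) auto
      also have "\<dots> = sqrt (N / n)" using n by (simp add: powr_half_sqrt)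
      also have "\<dots> \<le> 1 + 1 / (2 * n)"
        using n by (intro real_le_lsqrt) (auto simp: field_simps power2_eq_square)
      finally have "2 * n * (N / n) powr b \<le> 2 * n * (1 + 1 / (2 * n))" using n by (intro mult_left_mono) auto
      also have "\<dots> = 2 * N - 1" using n by (simp add: field_simps)
      finally have *: "1 + 2 * n * (N / n) powr b \<le> 2 * N" by simp
      have "N powr (- b) * (1 + 2 * n * (N / n) powr b) \<le> N powr (- b) * (2 * N)"
        using * by (intro mult_left_mono) auto
      moreover have "N powr (- b) * (2 * n * (N / n) powr b) = 2 * n powr (1 - b)"
        using n by (simp add: powr_divide powr_minus powr_diff)
      moreover have "N powr (- b) * (2 * N) = 2 * N powr (1 - b)"
        using n by (simp add: powr_minus powr_diff field_simps)
      ultimately have "N powr (- b) + 2 * n powr (1 - b) \<le> 2 * N powr (1 - b)"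
        by (simp add: distrib_left)
      then show ?thesis by (simp add: b_def)
    qed
    then have "m * (N powr (- 1 / real d) + 2 * real n powr (1 - 1 / real d)) \<le> m * (2 * N powr (1 - 1 / real d))"
      by (intro mult_left_mono) (auto simp: m_def)
    then show "m * N powr (- 1 / real d) + 1 + (2 * (m * real n powr (1 - 1 / real d)) + real n) \<le>
      2 * (m * N powr (1 - 1 / real d)) + N"
      by (simp add: algebra_simps N_def)
    show "deg_const a s \<ge> 0" by (simp add: deg_const_def)
  qed
  finally show ?case unfolding m_def N_def Suc.hyps(2) by simp
qed

end

text \<open>The case \<open>d = 1\<close>, where the preceding argument loses a logarithm.\<close>

lemma card_relation_le_cofinite:
  fixes adj :: "'x \<Rightarrow> 'y \<Rightarrow> bool"
  assumes fin: "finite P" "finite Q" and s: "s \<ge> 1"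
    and free: "\<And>A B. A \<subseteq> P \<Longrightarrow> B \<subseteq> Q \<Longrightarrow> card A = s \<Longrightarrow> card B = s \<Longrightarrow> \<exists>x\<in>A. \<exists>y\<in>B. \<not> adj x y"
    and dich: "\<And>x. x \<in> P \<Longrightarrow> card {y \<in> Q. adj x y} \<le> c \<or> card {y \<in> Q. \<not> adj x y} \<le> c"
  shows "(\<Sum>x\<in>P. card {y \<in> Q. adj x y}) \<le> (s * c + s) * (card P + card Q)"
proof (cases "card Q \<le> s * c + s")
  case True
  have "(\<Sum>x\<in>P. card {y \<in> Q. adj x y}) \<le> (\<Sum>x\<in>P. card Q)"
    using fin by (intro sum_mono card_mono) auto
  also have "\<dots> \<le> (s * c + s) * card P" using True by (simp add: mult.commute)
  finally show ?thesis by (simp add: distrib_left)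
next
  case False
  define F where "F = {x \<in> P. card {y \<in> Q. \<not> adj x y} \<le> c}"
  \<comment> \<open>If \<open>s\<close> vertices each miss at most \<open>c\<close> elements of
    \<open>Q\<close>, they have at least \<open>s\<close> common neighbours, since
    \<open>card Q\<close> exceeds \<open>s * c + s\<close>.\<close>
  have "card F < s"
  proof (rule ccontr)
    assume "\<not> ?thesis"
    then have "s \<le> card F" by simp
    from obtain_subset_with_card_n[OF this] obtain A where A: "A \<subseteq> F" "card A = s" by blast
    have "finite F" using fin by (simp add: F_def)
    then have fA: "finite A" using A finite_subset by blast
    have "card (\<Union>x\<in>A. {y \<in> Q. \<not> adj x y}) \<le> (\<Sum>x\<in>A. card {y \<in> Q. \<not> adj x y})"
      using fA by (rule card_UN_le)
    also have "\<dots> \<le> s * c" using sum_bounded_above[of A "\<lambda>x. card {y \<in> Q. \<not> adj x y}" c] A unfolding F_def by auto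
    finally have "s \<le> card (Q - (\<Union>x\<in>A. {y \<in> Q. \<not> adj x y}))"
      using False diff_card_le_card_Diff[of "\<Union>x\<in>A. {y \<in> Q. \<not> adj x y}" Q] fA fin by auto
    from obtain_subset_with_card_n[OF this]
    obtain B where B: "B \<subseteq> Q - (\<Union>x\<in>A. {y \<in> Q. \<not> adj x y})" "card B = s" by blast
    then show False using free[of A B] A unfolding F_def by blast
  qed
  have "(\<Sum>x\<in>P. card {y \<in> Q. adj x y}) \<le> (\<Sum>x\<in>P. c + (if x \<in> F then card Q else 0))"
  proof (rule sum_mono)
    fix x assume x: "x \<in> P"
    have "card {y \<in> Q. adj x y} \<le> card Q" using fin by (intro card_mono) auto
    then show "card {y \<in> Q. adj x y} \<le> c + (if x \<in> F then card Q else 0)"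
      using dich[OF x] x by (auto simp: F_def)
  qed
  also have "\<dots> = c * card P + card F * card Q"
  proof -
    have "P \<inter> F = F" by (auto simp: F_def)
    then show ?thesis using fin by (simp add: sum.distrib sum.If_cases)
  qed
  also have "\<dots> \<le> (s * c + s) * card P + (s * c + s) * card Q"
    using \<open>card F < s\<close> s by (intro add_mono mult_right_mono) (auto intro: trans_le_add1)
  finally show ?thesis by (simp add: distrib_left)
qed

section \<open>The upper bound\<close>

text \<open>Stated for a point of the joint space rather than for a pair, so that exchanging the
  parts changes only how the point is assembled.\<close>

definition zero_pattern_adj ::
  "'a ring \<Rightarrow> ((nat + nat) multiset \<Rightarrow> 'a) list \<Rightarrow> (bool list \<Rightarrow> bool) \<Rightarrow> (nat + nat \<Rightarrow> 'a) \<Rightarrow> bool" where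
  "zero_pattern_adj R fs \<Phi> z \<longleftrightarrow> \<Phi> (map (\<lambda>f. indexed_poly_eval R f z = \<zero>\<^bsub>R\<^esub>) fs)"

lemma Inl_Inr_doubleton_eq_iff: "{Inl x, Inr y} = {Inl x', Inr y'} \<longleftrightarrow> x = x' \<and> y = y'"
  by (auto simp: doubleton_eq_iff)

lemma mem_zero_pattern_edges:
  "{Inl x, Inr y} \<in> zero_pattern_edges R fs \<Phi> P Q \<longleftrightarrow>
    x \<in> P \<and> y \<in> Q \<and> zero_pattern_adj R fs \<Phi> (case_sum x y)"
  unfolding zero_pattern_edges_def zero_pattern_adj_def mem_Collect_eq Inl_Inr_doubleton_eq_iff by blast

lemma card_zero_pattern_edges:
  "card (zero_pattern_edges R fs \<Phi> P Q) =
    card {(x, y). x \<in> P \<and> y \<in> Q \<and> zero_pattern_adj R fs \<Phi> (case_sum x y)}"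
proof -
  let ?S = "{(x, y). x \<in> P \<and> y \<in> Q \<and> zero_pattern_adj R fs \<Phi> (case_sum x y)}"
  have "zero_pattern_edges R fs \<Phi> P Q = (\<lambda>(x, y). {Inl x, Inr y}) ` ?S"
    unfolding zero_pattern_edges_def zero_pattern_adj_def by auto
  moreover have "inj_on (\<lambda>(x, y). {Inl x, Inr y}) ?S"
    by (auto simp: inj_on_def doubleton_eq_iff)
  ultimately show ?thesis by (simp add: card_image)
qed

lemma card_zero_pattern_edges_sum:
  assumes "finite P" "finite Q"
  shows "card (zero_pattern_edges R fs \<Phi> P Q) =
      (\<Sum>y\<in>Q. card {x \<in> P. zero_pattern_adj R fs \<Phi> (case_sum x y)})"
    and "card (zero_pattern_edges R fs \<Phi> P Q) =
      (\<Sum>x\<in>P. card {y \<in> Q. zero_pattern_adj R fs \<Phi> (case_sum x y)})"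
proof -
  let ?adj = "\<lambda>x y. zero_pattern_adj R fs \<Phi> (case_sum x y)"
  have "{(x, y). x \<in> P \<and> y \<in> Q \<and> ?adj x y} = Sigma P (\<lambda>x. {y \<in> Q. ?adj x y})" by auto
  then show 1: "card (zero_pattern_edges R fs \<Phi> P Q) = (\<Sum>x\<in>P. card {y \<in> Q. ?adj x y})"
    unfolding card_zero_pattern_edges using assms by simp
  show "card (zero_pattern_edges R fs \<Phi> P Q) = (\<Sum>y\<in>Q. card {x \<in> P. ?adj x y})"
    unfolding 1 using assms by (intro sum_multicount_gen) auto
qed

text \<open>Every edge joins a left vertex to a right one, so a biclique in the disjoint union has
  one side in each part, though \<open>biclique_free\<close> leaves open which is which. Positive
  \<open>s\<close> makes both sides nonempty and finite.\<close>

lemma biclique_free_zero_pattern_edges: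
  assumes "s \<ge> 1"
  shows "biclique_free s (Sum_Type.Plus P Q) (zero_pattern_edges R fs \<Phi> P Q) \<longleftrightarrow>
    (\<forall>A B. A \<subseteq> P \<longrightarrow> B \<subseteq> Q \<longrightarrow> card A = s \<longrightarrow> card B = s \<longrightarrow>
      (\<exists>x\<in>A. \<exists>y\<in>B. \<not> zero_pattern_adj R fs \<Phi> (case_sum x y)))"
    (is "?free (zero_pattern_edges R fs \<Phi> P Q) \<longleftrightarrow> ?nobic")
proof
  let ?E = "zero_pattern_edges R fs \<Phi> P Q"
  assume free: "?free ?E"
  show ?nobic
  proof (intro allI impI, rule ccontr)
    fix A B assume *: "A \<subseteq> P" "B \<subseteq> Q" "card A = s" "card B = s"
      "\<not> (\<exists>x\<in>A. \<exists>y\<in>B. \<not> zero_pattern_adj R fs \<Phi> (case_sum x y))"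
    have "finite A" "finite B" using * assms by (metis card.infinite not_one_le_zero)+
    moreover have "card (Inl ` A) = s" "card (Inr ` B) = s"
      using * by (simp_all add: card_image)
    moreover have "\<forall>a\<in>Inl ` A. \<forall>b\<in>Inr ` B. {a, b} \<in> ?E"
      using * by (auto simp: mem_zero_pattern_edges)
    moreover have "Inl ` A \<subseteq> Sum_Type.Plus P Q" "Inr ` B \<subseteq> Sum_Type.Plus P Q" "Inl ` A \<inter> Inr ` B = {}"
      using *(1,2) by auto
    ultimately show False
      using free unfolding biclique_free_def by (meson finite_imageI)
  qed
next
  let ?E = "zero_pattern_edges R fs \<Phi> P Q"
  assume nobic: ?nobic
  \<comment> \<open>The vertex \<open>Inl x0\<close> forces all of \<open>B\<close> to the right,
    and a vertex of \<open>B\<close> then forces all of \<open>A\<close> to the left.\<close>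
  have main: False
    if AB: "card A = s" "card B = s" "\<forall>a\<in>A. \<forall>b\<in>B. {a, b} \<in> ?E" "x0 \<in> P" "Inl x0 \<in> A" for A B x0
  proof -
    have "A \<noteq> {}" "B \<noteq> {}" using AB(1,2) assms by auto
    have B: "b \<in> Inr ` Q" if "b \<in> B" for b
    proof -
      have "{Inl x0, b} \<in> ?E" using AB that by blast
      then show ?thesis unfolding zero_pattern_edges_def mem_Collect_eq
        by (auto simp only: doubleton_eq_iff Inl_Inr_False sum.inject)
    qed
    then obtain y0 where y0: "Inr y0 \<in> B" using \<open>B \<noteq> {}\<close> by blast
    have A: "a \<in> Inl ` P" if "a \<in> A" for a
    proof -
      have "{a, Inr y0} \<in> ?E" using AB that y0 by blast
      then show ?thesis unfolding zero_pattern_edges_def mem_Collect_eq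
        by (auto simp only: doubleton_eq_iff Inl_Inr_False sum.inject)
    qed
    obtain A' B' where A': "A' \<subseteq> P" "A = Inl ` A'" and B': "B' \<subseteq> Q" "B = Inr ` B'"
      using A B by (metis subsetI subset_imageE)
    have "card A' = s" "card B' = s" using AB(1,2) A' B' by (simp_all add: card_image)
    then obtain x y where "x \<in> A'" "y \<in> B'" "\<not> zero_pattern_adj R fs \<Phi> (case_sum x y)"
      using nobic A' B' by blast
    moreover have "{Inl x, Inr y} \<in> ?E" using AB(3) A' B' \<open>x \<in> A'\<close> \<open>y \<in> B'\<close> by blast
    ultimately show False unfolding mem_zero_pattern_edges by blast
  qed
  show "?free ?E"
    unfolding biclique_free_def
  proof (rule notI, elim exE conjE)
    fix A B :: "((nat \<Rightarrow> 'a) + (nat \<Rightarrow> 'a)) set"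
    assume AB: "card A = s" "card B = s" "\<forall>a\<in>A. \<forall>b\<in>B. {a, b} \<in> ?E"
    have "A \<noteq> {}" "B \<noteq> {}" using AB(1,2) assms by auto
    then obtain a b where ab: "a \<in> A" "b \<in> B" by blast
    then have "{a, b} \<in> ?E" using AB by blast
    then obtain x y where x: "x \<in> P" "{a, b} = {Inl x, Inr y}" unfolding zero_pattern_edges_def mem_Collect_eq by blast
    then consider "Inl x \<in> A" | "Inl x \<in> B" using ab by (auto simp: doubleton_eq_iff)
    then show False
    proof cases
      case 1
      then show False using main[of A B x] AB x by blast
    next
      case 2
      have "{a, b} \<in> ?E" if "a \<in> B" "b \<in> A" for a b
        using AB(3) that by (subst insert_commute) blast
      then show False using main[of B A x] AB x 2 by blast
    qed
  qed
qed

text \<open>For \<open>d = 1\<close> the constant of \<open>card_relation_le_cofinite\<close> with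
  \<open>c = t * t\<close>. Otherwise the constant of the deletion argument with
  \<open>a = t * t\<close>, doubled to absorb the factor 2 of its main term.\<close>

definition edge_const :: "nat \<Rightarrow> nat \<Rightarrow> nat \<Rightarrow> real" where
  "edge_const t s d = (if d = 1 then real (s * (t * t) + s) else 2 * deg_const (t * t) s)"

section \<open>Edge bounds for zero pattern graphs over a field\<close>

context plain_field
begin

text \<open>In the following lemmas \<open>w x\<close> and \<open>\<zeta> y\<close> are points whose coordinates outside and inside \<open>J\<close>,
  respectively, make up the point \<open>c x y\<close>, so that both roles of the two parts are covered.\<close>

lemma card_traces_le:
  assumes I: "finite I" "J \<subseteq> I"
    and fs: "\<And>f. f \<in> set fs \<Longrightarrow> f \<in> indexed_pset I (carrier R) \<and> total_degree_le R f t" "length fs \<le> t"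
    and w: "\<And>x. x \<in> S \<Longrightarrow> w x \<in> I \<rightarrow> carrier R" and \<zeta>: "\<And>y. y \<in> Q \<Longrightarrow> \<zeta> y \<in> I \<rightarrow> carrier R"
    and c: "\<And>x y v. v \<in> I \<Longrightarrow> c x y v = override_on (w x) (\<zeta> y) J v"
    and S: "finite S" and Q: "finite Q"
  shows "card ((\<lambda>y. {x \<in> S. zero_pattern_adj R fs \<Phi> (c x y)}) ` Q) \<le> (t * t * card S + 1) ^ card J"
proof -
  \<comment> \<open>One polynomial in the \<open>J\<close>-coordinates for each sampled point and
    each member of \<open>fs\<close>. There are at most \<open>t * card S\<close> of them, each of
    degree at most \<open>t\<close>, whence the factor \<open>t * t\<close>.\<close>
  define K where "K = S \<times> {..<length fs}"
  define g where "g = (\<lambda>(x, i) z. indexed_poly_eval R (fs ! i) (override_on (w x) z J))"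
  define pat where "pat z = {k \<in> K. g k z \<noteq> \<zero>}" for z
  \<comment> \<open>The trace is a function of the zero pattern, whatever \<open>\<Phi>\<close> is,
    so there are no more traces than patterns.\<close>
  define \<psi> where "\<psi> T = {x \<in> S. \<Phi> (map (\<lambda>i. (x, i) \<notin> T) [0..<length fs])}" for T
  have fJ: "finite J" using I finite_subset by blast
  have g: "g k \<in> poly_funs J t" if "k \<in> K" for k
    using that fs(1) w I indexed_poly_eval_override_poly_funs[of I J _ t] by (auto simp: K_def g_def)
  have "{x \<in> S. zero_pattern_adj R fs \<Phi> (c x y)} = \<psi> (pat (\<zeta> y))" if y: "y \<in> Q" for y
  proof -
    have "indexed_poly_eval R (fs ! i) (c x y) = g (x, i) (\<zeta> y)" if "x \<in> S" "i < length fs" for x i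
    proof -
      have "override_on (w x) (\<zeta> y) J \<in> I \<rightarrow> carrier R"
        using w[OF that(1)] \<zeta>[OF y] by (auto simp: override_on_def Pi_iff)
      then show ?thesis
        using fs(1)[of "fs ! i"] that(2) I(1) c by (auto simp: g_def intro!: indexed_poly_eval_cong)
    qed
    then have "map (\<lambda>f. indexed_poly_eval R f (c x y) = \<zero>) fs =
      map (\<lambda>i. (x, i) \<notin> pat (\<zeta> y)) [0..<length fs]" if "x \<in> S" for x
      using that by (intro nth_equalityI) (auto simp: pat_def K_def)
    then show ?thesis unfolding zero_pattern_adj_def \<psi>_def by auto
  qed
  then have "(\<lambda>y. {x \<in> S. zero_pattern_adj R fs \<Phi> (c x y)}) ` Q = \<psi> ` pat ` \<zeta> ` Q"
    by (auto simp: image_image)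
  then have "card ((\<lambda>y. {x \<in> S. zero_pattern_adj R fs \<Phi> (c x y)}) ` Q) \<le> card (pat ` \<zeta> ` Q)"
    using Q by (simp add: card_image_le)
  also have "\<dots> \<le> (t * card K + 1) ^ card J"
    unfolding pat_def
  proof (rule zero_pattern_card_le[OF fJ])
    show "\<zeta> ` Q \<subseteq> J \<rightarrow> carrier R"
    proof clarify
      fix y v assume "y \<in> Q" "v \<in> J"
      then show "\<zeta> y v \<in> carrier R" using \<zeta>[of y] I(2) by auto
    qed
  qed (use S g in \<open>auto simp: K_def\<close>)
  also have "\<dots> \<le> (t * t * card S + 1) ^ card J"
  proof -
    have "card K \<le> t * card S" using fs(2) by (simp add: K_def card_cartesian_product mult.commute)
    then have "t * card K + 1 \<le> t * t * card S + 1" by simp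
    then show ?thesis by (intro power_mono) auto
  qed
  finally show ?thesis .
qed

text \<open>On a line, a polynomial of degree at most \<open>t\<close> vanishes at all points of
  \<open>Q\<close> or at no more than \<open>t\<close> of them. Away from the at most
  \<open>t * t\<close> zeros of the second kind all truth values are constant, and so is
  adjacency.\<close>

lemma zero_pattern_line_dichotomy:
  assumes I: "finite I" "v \<in> I"
    and fs: "\<And>f. f \<in> set fs \<Longrightarrow> f \<in> indexed_pset I (carrier R) \<and> total_degree_le R f t" "length fs \<le> t"
    and w: "w \<in> I \<rightarrow> carrier R" and \<zeta>: "\<And>y. y \<in> Q \<Longrightarrow> \<zeta> y \<in> I \<rightarrow> carrier R"
    and inj: "inj_on (\<lambda>y. \<zeta> y v) Q"
    and c: "\<And>y u. u \<in> I \<Longrightarrow> c y u = override_on w (\<zeta> y) {v} u"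
    and Q: "finite Q"
  shows "card {y \<in> Q. zero_pattern_adj R fs \<Phi> (c y)} \<le> t * t \<or>
    card {y \<in> Q. \<not> zero_pattern_adj R fs \<Phi> (c y)} \<le> t * t"
proof -
  define g where "g i z = indexed_poly_eval R (fs ! i) (override_on w z {v})" for i z
  have eval: "indexed_poly_eval R (fs ! i) (c y) = g i (\<zeta> y)" if "y \<in> Q" "i < length fs" for y i
  proof -
    have "override_on w (\<zeta> y) {v} \<in> I \<rightarrow> carrier R"
      using w \<zeta>[OF that(1)] by (auto simp: override_on_def Pi_iff)
    then show ?thesis
      using fs(1)[of "fs ! i"] that(2) I(1) c by (auto simp: g_def intro!: indexed_poly_eval_cong)
  qed
  define zeros where "zeros i = {y \<in> Q. g i (\<zeta> y) = \<zero>}" for i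
  define small where "small = {i \<in> {..<length fs}. card (zeros i) \<le> t}"
  define bad where "bad = (\<Union>i\<in>small. zeros i)"
  have "card bad \<le> (\<Sum>i\<in>small. card (zeros i))" unfolding bad_def by (rule card_UN_le) (simp add: small_def)
  also have "\<dots> \<le> card small * t" using sum_bounded_above[of small "\<lambda>i. card (zeros i)" t] by (auto simp: small_def)
  also have "\<dots> \<le> t * t"
  proof (rule mult_right_mono)
    have "card small \<le> card {..<length fs}" by (intro card_mono) (auto simp: small_def)
    then show "card small \<le> t" using fs(2) by simp
  qed simp
  finally have bad: "card bad \<le> t * t" .
  have fbad: "finite bad" unfolding bad_def small_def zeros_def using Q by auto
  have large: "g i (\<zeta> y) = \<zero>" if i: "i < length fs" "i \<notin> small" and y: "y \<in> Q" for i y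
  proof -
    have "t + 1 \<le> card (zeros i)" using i by (auto simp: small_def)
    from obtain_subset_with_card_n[OF this]
    obtain T where T: "T \<subseteq> zeros i" "card T = t + 1" "finite T" by blast
    have TQ: "T \<subseteq> Q" using T by (auto simp: zeros_def)
    have "inj_on \<zeta> T"
    proof (rule inj_onI)
      fix y y' assume "y \<in> T" "y' \<in> T" "\<zeta> y = \<zeta> y'"
      then show "y = y'" using TQ by (intro inj_onD[OF inj]) auto
    qed
    then have card: "card (\<zeta> ` T) = t + 1" using T by (simp add: card_image)
    have inj': "inj_on (\<lambda>z. z v) (\<zeta> ` T)" using inj TQ by (auto simp: inj_on_def subset_iff)
    have "g i \<in> poly_funs {v} t"
      unfolding g_def using fs(1)[of "fs ! i"] i(1) I w
      by (intro indexed_poly_eval_override_poly_funs[of I]) auto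
    moreover have "\<zeta> ` T \<subseteq> {v} \<rightarrow> carrier R" using \<zeta> TQ I(2) by auto
    moreover have "\<zeta> y \<in> {v} \<rightarrow> carrier R" using \<zeta> y I(2) by auto
    ultimately show ?thesis
      using poly_funs_singleton_eq_zero[of "g i" v t "\<zeta> ` T"] inj' card T by (auto simp: zeros_def)
  qed
  define b where "b \<longleftrightarrow> \<Phi> (map (\<lambda>i. i \<notin> small) [0..<length fs])"
  have "zero_pattern_adj R fs \<Phi> (c y) \<longleftrightarrow> b" if y: "y \<in> Q - bad" for y
  proof -
    have "map (\<lambda>f. indexed_poly_eval R f (c y) = \<zero>) fs = map (\<lambda>i. i \<notin> small) [0..<length fs]"
    proof (intro nth_equalityI)
      fix i assume "i < length (map (\<lambda>f. indexed_poly_eval R f (c y) = \<zero>) fs)"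
      then have i: "i < length fs" by simp
      have "g i (\<zeta> y) = \<zero> \<longleftrightarrow> i \<notin> small"
        using large[OF i] y by (auto simp: bad_def zeros_def)
      then show "map (\<lambda>f. indexed_poly_eval R f (c y) = \<zero>) fs ! i = map (\<lambda>i. i \<notin> small) [0..<length fs] ! i"
        using i eval y by simp
    qed simp
    then show ?thesis unfolding zero_pattern_adj_def b_def by simp
  qed
  then have "{y \<in> Q. zero_pattern_adj R fs \<Phi> (c y)} \<subseteq> bad \<or> {y \<in> Q. \<not> zero_pattern_adj R fs \<Phi> (c y)} \<subseteq> bad"
    by blast
  then show ?thesis using bad fbad card_mono[OF fbad] by (meson order_trans)
qed

text \<open>For \<open>d = 1\<close> the dichotomy concerns neighbourhoods inside \<open>Q\<close>,
  so the order of counting is exchanged; for larger \<open>d\<close> adjacency is an instance of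
  \<open>sparse_relation\<close>, with traces bounded by the zero pattern theorem.\<close>

lemma zero_pattern_incidences_le:
  assumes I: "finite I" "J \<subseteq> I"
    and fs: "\<And>f. f \<in> set fs \<Longrightarrow> f \<in> indexed_pset I (carrier R) \<and> total_degree_le R f t" "length fs \<le> t"
    and w: "\<And>x. x \<in> P \<Longrightarrow> w x \<in> I \<rightarrow> carrier R" and \<zeta>: "\<And>y. y \<in> Q \<Longrightarrow> \<zeta> y \<in> I \<rightarrow> carrier R"
    and sep: "\<And>y y'. y \<in> Q \<Longrightarrow> y' \<in> Q \<Longrightarrow> y \<noteq> y' \<Longrightarrow> \<exists>v\<in>J. \<zeta> y v \<noteq> \<zeta> y' v"
    and c: "\<And>x y v. v \<in> I \<Longrightarrow> c x y v = override_on (w x) (\<zeta> y) J v"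
    and fin: "finite P" "finite Q" and s: "s \<ge> 1" and d: "card J = d" "d \<ge> 1"
    and free: "\<And>A B. A \<subseteq> P \<Longrightarrow> B \<subseteq> Q \<Longrightarrow> card A = s \<Longrightarrow> card B = s \<Longrightarrow>
      \<exists>x\<in>A. \<exists>y\<in>B. \<not> zero_pattern_adj R fs \<Phi> (c x y)"
  shows "real (\<Sum>y\<in>Q. card {x \<in> P. zero_pattern_adj R fs \<Phi> (c x y)}) \<le>
    edge_const t s d * (real (card P) * real (card Q) powr (1 - 1 / real d) + real (card P) + real (card Q))"
proof (cases "d = 1")
  case True
  then obtain v where J: "J = {v}" using d card_1_singletonE by metis
  have "inj_on (\<lambda>y. \<zeta> y v) Q" using sep unfolding J inj_on_def by blast
  then have dich: "card {y \<in> Q. zero_pattern_adj R fs \<Phi> (c x y)} \<le> t * t \<or>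
    card {y \<in> Q. \<not> zero_pattern_adj R fs \<Phi> (c x y)} \<le> t * t" if "x \<in> P" for x
    using I fs w[OF that] \<zeta> c fin unfolding J
    by (intro zero_pattern_line_dichotomy[of I v fs t "w x" Q \<zeta>]) auto
  have "(\<Sum>y\<in>Q. card {x \<in> P. zero_pattern_adj R fs \<Phi> (c x y)}) =
    (\<Sum>x\<in>P. card {y \<in> Q. zero_pattern_adj R fs \<Phi> (c x y)})"
    using fin by (intro sum_multicount_gen[symmetric]) auto
  also have "\<dots> \<le> (s * (t * t) + s) * (card P + card Q)"
    by (rule card_relation_le_cofinite[OF fin s free dich])
  finally have "real (\<Sum>y\<in>Q. card {x \<in> P. zero_pattern_adj R fs \<Phi> (c x y)}) \<le>
    real ((s * (t * t) + s) * (card P + card Q))" by (simp only: of_nat_le_iff)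
  also have "\<dots> = edge_const t s d * (real (card P) + real (card Q))"
    using True by (simp add: edge_const_def)
  also have "\<dots> \<le> edge_const t s d * (real (card P) * real (card Q) powr (1 - 1 / real d) + real (card P) + real (card Q))"
    by (intro mult_left_mono) (auto simp: edge_const_def deg_const_def)
  finally show ?thesis .
next
  case False
  interpret sparse_relation P "\<lambda>x y. zero_pattern_adj R fs \<Phi> (c x y)" Q "t * t" d s
  proof
    fix S assume S: "S \<subseteq> P"
    show "card ((\<lambda>y. {x \<in> S. zero_pattern_adj R fs \<Phi> (c x y)}) ` Q) \<le> (t * t * card S + 1) ^ d"
      unfolding d(1)[symmetric] using S w fin finite_subset
      by (intro card_traces_le[OF I fs _ \<zeta> c]) auto
  qed (use fin free in auto)
  have "real (\<Sum>y\<in>Q. card {x \<in> P. zero_pattern_adj R fs \<Phi> (c x y)}) \<le>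
    deg_const (t * t) s * (2 * (real (card P) * real (card Q) powr (1 - 1 / real d)) + real (card Q))"
    using card_relation_le[OF order_refl s] False d by auto
  also have "\<dots> \<le> deg_const (t * t) s *
    (2 * (real (card P) * real (card Q) powr (1 - 1 / real d) + real (card P) + real (card Q)))"
    by (intro mult_left_mono) (auto simp: deg_const_def)
  also have "\<dots> = edge_const t s d * (real (card P) * real (card Q) powr (1 - 1 / real d) + real (card P) + real (card Q))"
    using False by (simp add: edge_const_def)
  finally show ?thesis .
qed

lemma algebraic_graph_card_edges_le:
  assumes G: "algebraic_graph_le R d1 d2 t P Q E" and fin: "finite P" "finite Q"
    and free: "biclique_free s (Sum_Type.Plus P Q) E" and d: "d1 \<ge> 1" "d2 \<ge> 1"
  shows "real (card E) \<le> (edge_const t s d1 + edge_const t s d2) *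
    (zarankiewicz_term d1 d2 (card P) (card Q) + real (card P) + real (card Q))"
proof -
  obtain t' fs \<Phi> where t': "t' \<le> t" "length fs = t'" and PQ: "P \<subseteq> affine_space R d1" "Q \<subseteq> affine_space R d2"
    and fs: "\<And>f. f \<in> set fs \<Longrightarrow> f \<in> bipoly_set R d1 d2 \<and> total_degree_le R f t'"
    and E: "E = zero_pattern_edges R fs \<Phi> P Q"
    using G unfolding algebraic_graph_le_def algebraic_graph_def by blast
  \<comment> \<open>The biclique with empty sides is always present, so freeness excludes
    \<open>s = 0\<close>.\<close>
  have s: "s \<ge> 1"
  proof (rule ccontr)
    assume "\<not> s \<ge> 1"
    then have "s = 0" by simp
    then show False using free unfolding biclique_free_def by (auto dest!: spec[of _ "{}"])
  qed
  define I :: "(nat + nat) set" where "I = Sum_Type.Plus {..<d1} {..<d2}"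
  define J1 J2 :: "(nat + nat) set" where "J1 = Inl ` {..<d1}" and "J2 = Inr ` {..<d2}"
  have I: "finite I" "J1 \<subseteq> I" "J2 \<subseteq> I" by (auto simp: I_def J1_def J2_def)
  have cardJ: "card J1 = d1" "card J2 = d2" by (auto simp: J1_def J2_def card_image)
  have fs': "f \<in> indexed_pset I (carrier R) \<and> total_degree_le R f t" if "f \<in> set fs" for f
    using fs[OF that] t' unfolding bipoly_set_def I_def total_degree_le_def by (meson order_trans)
  have len: "length fs \<le> t" using t' by simp
  \<comment> \<open>The missing coordinates are filled with zero so that both maps give points over
    the carrier; \<open>override_on\<close> puts the coordinates of the other point in their
    place.\<close>
  define \<xi> :: "(nat \<Rightarrow> 'a) \<Rightarrow> nat + nat \<Rightarrow> 'a" where "\<xi> x = case_sum x (\<lambda>_. \<zero>)" for x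
  define \<eta> :: "(nat \<Rightarrow> 'a) \<Rightarrow> nat + nat \<Rightarrow> 'a" where "\<eta> y = case_sum (\<lambda>_. \<zero>) y" for y
  have \<xi>: "\<xi> x \<in> I \<rightarrow> carrier R" if "x \<in> P" for x
    using that PQ by (auto simp: \<xi>_def I_def affine_space_def PiE_iff)
  have \<eta>: "\<eta> y \<in> I \<rightarrow> carrier R" if "y \<in> Q" for y
    using that PQ by (auto simp: \<eta>_def I_def affine_space_def PiE_iff)
  have sep1: "\<exists>v\<in>J1. \<xi> x v \<noteq> \<xi> x' v" if "x \<in> P" "x' \<in> P" and ne: "x \<noteq> x'" for x x'
  proof -
    have "x \<in> {..<d1} \<rightarrow>\<^sub>E carrier R" "x' \<in> {..<d1} \<rightarrow>\<^sub>E carrier R"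
      using that PQ by (auto simp: affine_space_def)
    then obtain i where "i < d1" "x i \<noteq> x' i" using ne PiE_ext by (metis lessThan_iff)
    then show ?thesis by (auto simp: J1_def \<xi>_def)
  qed
  have sep2: "\<exists>v\<in>J2. \<eta> y v \<noteq> \<eta> y' v" if "y \<in> Q" "y' \<in> Q" and ne: "y \<noteq> y'" for y y'
  proof -
    have "y \<in> {..<d2} \<rightarrow>\<^sub>E carrier R" "y' \<in> {..<d2} \<rightarrow>\<^sub>E carrier R"
      using that PQ by (auto simp: affine_space_def)
    then obtain i where "i < d2" "y i \<noteq> y' i" using ne PiE_ext by (metis lessThan_iff)
    then show ?thesis by (auto simp: J2_def \<eta>_def)
  qed
  have c1: "case_sum x y v = override_on (\<eta> y) (\<xi> x) J1 v"
    and c2: "case_sum x y v = override_on (\<xi> x) (\<eta> y) J2 v" if "v \<in> I" for x y v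
    using that by (auto simp: I_def J1_def J2_def \<xi>_def \<eta>_def override_on_def)
  have nobic: "\<exists>x\<in>A. \<exists>y\<in>B. \<not> zero_pattern_adj R fs \<Phi> (case_sum x y)"
    if "A \<subseteq> P" "B \<subseteq> Q" "card A = s" "card B = s" for A B
    using free that unfolding E biclique_free_zero_pattern_edges[OF s] by blast
  then have nobic': "\<exists>y\<in>B. \<exists>x\<in>A. \<not> zero_pattern_adj R fs \<Phi> (case_sum x y)"
    if "B \<subseteq> Q" "A \<subseteq> P" "card B = s" "card A = s" for A B using that by blast
  define m n where "m = real (card P)" and "n = real (card Q)"
  \<comment> \<open>Each order of the parts gives one term of the minimum. The sum of the two
    constants serves for both, so the smaller term can be taken.\<close>
  have "real (card E) \<le> edge_const t s d2 * (m * n powr (1 - 1 / real d2) + m + n)"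
    unfolding E card_zero_pattern_edges_sum(1)[OF fin] m_def n_def
    by (rule zero_pattern_incidences_le[OF I(1,3) fs' len \<xi> \<eta> sep2 c2 fin s cardJ(2) d(2) nobic])
  moreover have "real (card E) \<le> edge_const t s d1 * (n * m powr (1 - 1 / real d1) + n + m)"
    unfolding E card_zero_pattern_edges_sum(2)[OF fin] m_def n_def
    by (rule zero_pattern_incidences_le[OF I(1,2) fs' len \<eta> \<xi> sep1 c1 fin(2,1) s cardJ(1) d(1) nobic'])
  moreover have pos: "edge_const t s d1 \<ge> 0" "edge_const t s d2 \<ge> 0"
    by (auto simp: edge_const_def deg_const_def)
  moreover have nn: "0 \<le> m" "0 \<le> n" by (auto simp: m_def n_def)
  moreover have "edge_const t s d2 * (m * n powr (1 - 1 / real d2) + m + n) \<le>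
    (edge_const t s d1 + edge_const t s d2) * (m * n powr (1 - 1 / real d2) + m + n)"
    using pos nn by (intro mult_right_mono) auto
  moreover have "edge_const t s d1 * (n * m powr (1 - 1 / real d1) + n + m) \<le>
    (edge_const t s d1 + edge_const t s d2) * (n * m powr (1 - 1 / real d1) + n + m)"
    using pos nn by (intro mult_right_mono) auto
  ultimately show ?thesis
    unfolding zarankiewicz_term_def m_def[symmetric] n_def[symmetric] min_def
    by (auto simp: mult.commute add.commute add.left_commute)
qed

end

section \<open>Primes in short intervals\<close>

text \<open>The Leibniz harmonic triangle \<open>1 / (m (n choose m))\<close>: its entries in row \<open>n\<close> are integer
  combinations of \<open>1, 1/2, \<dots>, 1/n\<close>.\<close>

lemma mult_binomial_dvd_Lcm:
  assumes "1 \<le> m" "m \<le> n"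
  shows "m * (n choose m) dvd Lcm {1..n}"
  using assms
proof (induction m arbitrary: n rule: nat_induct_at_least)
  case base
  then show ?case by (auto intro: dvd_Lcm)
next
  case (Suc m)
  have mono: "Lcm {1..n - 1} dvd Lcm {1..n}" by (intro Lcm_subset) auto
  have "m * ((n - 1) choose m) dvd Lcm {1..n}" "m * (n choose m) dvd Lcm {1..n}"
    using dvd_trans[OF Suc.IH[of "n - 1"] mono] Suc.IH[of n] Suc.prems by simp_all
  then obtain u v where u: "Lcm {1..n} = m * ((n - 1) choose m) * u"
    and v: "Lcm {1..n} = m * (n choose m) * v"
    unfolding dvd_def by blast
  define B C D where "B = (n - 1) choose m" and "C = n choose m" and "D = n choose Suc m"
  have n: "n = Suc (n - 1)" using Suc.prems by simp
  have pos: "B > 0" "C > 0" "m > 0" using Suc by (auto simp: B_def C_def)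
  have D: "Suc m * D = n * B" unfolding D_def B_def using Suc_times_binomial_eq[of "n - 1" m] n by (simp add: mult.commute)
  have C: "(n - m) * C = n * B"
    unfolding C_def B_def using binomial_absorb_comp[of n m] by simp
  have BC: "B * u = C * v" using u v pos by (simp add: B_def C_def)
  \<comment> \<open>Leibniz's identity \<open>1 / ((m + 1) * D) = 1 / (m * B) - 1 / (m * C)\<close>
    multiplied by the least common multiple: \<open>u\<close> and \<open>v\<close> are its quotients
    by \<open>m * B\<close> and \<open>m * C\<close>, so \<open>u - v\<close> is the quotient by
    \<open>Suc m * D\<close>.\<close>
  have "Suc m * D * (u - v) = n * B * (u - v)" by (simp only: D)
  also have "\<dots> = n * (B * u) - n * B * v" by (simp only: diff_mult_distrib2 mult.assoc)
  also have "\<dots> = n * C * v - (n - m) * C * v" unfolding BC C by (simp only: mult.assoc)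
  also have "\<dots> = (n - (n - m)) * C * v" by (simp only: diff_mult_distrib)
  also have "\<dots> = m * C * v" using Suc.prems by simp
  also have "\<dots> = Lcm {1..n}" using v by (simp add: C_def)
  finally show ?case unfolding D_def by (metis dvd_triv_left)
qed

text \<open>The multiplicity of a prime in a least common multiple is a maximum over the members.
  This bounds every prime power in \<open>Lcm {1..n}\<close> by \<open>n\<close>.\<close>

lemma prime_power_dvd_Lcm_nat:
  fixes p :: nat
  assumes "prime p" "finite A" "p ^ k dvd Lcm A" "k > 0"
  shows "\<exists>a\<in>A. p ^ k dvd a"
  using assms(2,3)
proof (induction A)
  case empty
  then show ?case using assms(1,4) by simp
next
  case (insert a A)
  have "p ^ k dvd a \<or> p ^ k dvd Lcm A"
  proof (cases "a = 0 \<or> Lcm A = 0")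
    case True
    then show ?thesis by auto
  next
    case False
    then have "multiplicity p (lcm a (Lcm A)) = max (multiplicity p a) (multiplicity p (Lcm A))"
      using assms(1) by (intro multiplicity_lcm) auto
    moreover have "k \<le> multiplicity p (lcm a (Lcm A))"
      using insert.prems assms(1) False by (intro multiplicity_geI) (auto simp: prime_gt_1_nat)
    ultimately have "k \<le> multiplicity p a \<or> k \<le> multiplicity p (Lcm A)" by auto
    then show ?thesis by (meson multiplicity_dvd')
  qed
  then show ?case using insert.IH by auto
qed

text \<open>Each prime contributes a power of at most \<open>n\<close>, and a prime above
  \<open>sqrt n\<close> only its first power. The at most \<open>sqrt n\<close> smaller primes cost
  one factor \<open>n\<close> each.\<close>

lemma Lcm_le_primes:
  assumes "n \<ge> 1"
  shows "real (Lcm {1..n}) \<le> real n powr sqrt n * real (\<Prod>{p. prime p \<and> p \<le> n})"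
proof -
  define A where "A = {p. prime p \<and> p \<le> n}"
  define A1 where "A1 = {p \<in> A. real p \<le> sqrt n}"
  define e where "e p = multiplicity p (Lcm {1..n})" for p
  have fin: "finite A" unfolding A_def by (rule finite_subset[of _ "{..n}"]) auto
  have L0: "Lcm {1..n} \<noteq> 0" by (simp add: Lcm_0_iff)
  have pe: "p ^ e p \<le> n" if "prime p" for p
  proof (cases "e p = 0")
    case True
    then show ?thesis using assms by simp
  next
    case False
    have "p ^ e p dvd Lcm {1..n}" unfolding e_def by (rule multiplicity_dvd)
    from prime_power_dvd_Lcm_nat[OF that _ this] obtain a where "a \<in> {1..n}" "p ^ e p dvd a"
      using False by blast
    then show ?thesis using dvd_imp_le[of "p ^ e p" a] by simp
  qed
  have sub: "prime_factors (Lcm {1..n}) \<subseteq> A"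
  proof
    fix p assume p: "p \<in> prime_factors (Lcm {1..n})"
    then have "prime p" "e p > 0"
      unfolding e_def by (auto simp: prime_factors_multiplicity)
    then have "p ^ 1 \<le> p ^ e p" by (intro power_increasing) (auto simp: prime_gt_0_nat Suc_leI)
    then show "p \<in> A" using pe[OF \<open>prime p\<close>] \<open>prime p\<close> by (simp add: A_def)
  qed
  have "Lcm {1..n} = (\<Prod>p\<in>prime_factors (Lcm {1..n}). p ^ e p)"
    unfolding e_def using L0 prime_factorization_nat by blast
  also have "\<dots> = (\<Prod>p\<in>A. p ^ e p)"
    using sub fin by (intro prod.mono_neutral_left) (auto simp: A_def e_def prime_factors_multiplicity)
  also have "\<dots> \<le> (\<Prod>p\<in>A. (if p \<in> A1 then n else 1) * p)"
  proof (rule prod_mono, intro conjI)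
    fix p assume p: "p \<in> A"
    show "p ^ e p \<le> (if p \<in> A1 then n else 1) * p"
    proof (cases "p \<in> A1")
      case True
      then show ?thesis using pe[of p] p prime_ge_1_nat[of p] by (auto simp: A_def intro: order_trans)
    next
      case False
      have "e p \<le> 1"
      proof (rule ccontr)
        assume "\<not> ?thesis"
        then have "p ^ 2 \<le> p ^ e p" using p by (intro power_increasing) (auto simp: A_def prime_gt_0_nat Suc_leI)
        then have "p ^ 2 \<le> n" using pe[of p] p by (simp add: A_def)
        then have "real p ^ 2 \<le> n" by (metis of_nat_le_iff of_nat_power)
        then have "real p \<le> sqrt n" by (rule real_le_rsqrt)
        then show False using False p by (simp add: A1_def)
      qed
      then have "p ^ e p \<le> p ^ 1" using p by (intro power_increasing) (auto simp: A_def prime_gt_0_nat Suc_leI)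
      then show ?thesis using False by simp
    qed
  qed simp
  also have "\<dots> = n ^ card A1 * \<Prod>A"
  proof -
    have "A \<inter> A1 = A1" by (auto simp: A1_def)
    then show ?thesis using fin by (simp add: prod.distrib prod.If_cases)
  qed
  finally have "real (Lcm {1..n}) \<le> real n ^ card A1 * real (\<Prod>A)"
    by (metis of_nat_le_iff of_nat_mult of_nat_power)
  also have "real n ^ card A1 \<le> real n powr sqrt n"
  proof -
    have "A1 \<subseteq> {1..nat \<lfloor>sqrt n\<rfloor>}"
    proof
      fix p assume "p \<in> A1"
      then have "prime p" "real p \<le> sqrt n" by (auto simp: A1_def A_def)
      then show "p \<in> {1..nat \<lfloor>sqrt n\<rfloor>}" using prime_ge_1_nat[of p] by (auto simp: le_nat_floor)
    qed
    then have "card A1 \<le> nat \<lfloor>sqrt n\<rfloor>" by (metis card_atLeastAtMost card_mono diff_Suc_1 finite_atLeastAtMost)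
    then have "real (card A1) \<le> sqrt n"
      by (meson of_nat_floor of_nat_le_iff order_trans real_sqrt_ge_zero of_nat_0_le_iff)
    then show ?thesis using assms by (simp add: powr_realpow[symmetric] powr_mono)
  qed
  finally show ?thesis by (simp add: A_def mult_right_mono prod_nonneg)
qed

lemma prod_primes_dvd:
  fixes N :: nat
  assumes "finite A" "\<And>p. p \<in> A \<Longrightarrow> prime p" "\<And>p. p \<in> A \<Longrightarrow> p dvd N"
  shows "\<Prod>A dvd N"
  using assms
proof (induction A)
  case (insert p A)
  have "coprime p (\<Prod>A)"
  proof (rule prod_coprime_right)
    fix r assume "r \<in> A"
    then show "coprime p r" using insert by (intro primes_coprime) auto
  qed
  then show ?case using insert by (simp add: divides_mult)
qed simp

text \<open>Erdos's argument: the primes in the interval from \<open>k\<close> to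
  \<open>2 * k\<close> all divide the central binomial coefficient, which is at most
  \<open>4 ^ k\<close>.\<close>

lemma primorial_le: "\<Prod>{p. prime p \<and> p \<le> n} \<le> (4::nat) ^ (2 * n)"
proof (induction n rule: less_induct)
  case (less n)
  show ?case
  proof (cases "n \<le> 1")
    case True
    then have "{p. prime p \<and> p \<le> n} = {}" by (auto dest: prime_gt_1_nat)
    then show ?thesis by (simp only: prod.empty one_le_power)
  next
    case False
    \<comment> \<open>Half of \<open>n\<close>, rounded up. The induction produces the exponent
      \<open>2 * k + k\<close>, and the exponent \<open>2 * n\<close> of the claim leaves enough
      room for the rounding.\<close>
    define k where "k = (n + 1) div 2"
    have k: "k < n" "n \<le> 2 * k" "3 * k \<le> 2 * n" using False by (auto simp: k_def)
    let ?A = "{p. prime p \<and> p \<le> k}" and ?M = "{p. prime p \<and> k < p \<and> p \<le> 2 * k}"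
    have fin: "finite ?A" "finite ?M" by (auto intro: finite_subset[of _ "{..2 * k}"])
    have "\<Prod>?M dvd (2 * k choose k)"
    proof (rule prod_primes_dvd)
      fix p assume p: "p \<in> ?M"
      have "p dvd fact (2 * k)" using p by (simp add: prime_dvd_fact_iff)
      moreover have "fact (2 * k) = fact k * fact k * (2 * k choose k)"
        using binomial_fact_lemma[of k "2 * k"] by (simp add: mult_2)
      moreover have "\<not> p dvd fact k" using p by (simp add: prime_dvd_fact_iff)
      ultimately show "p dvd (2 * k choose k)"
        using p by (auto simp: prime_dvd_mult_iff)
    qed (use fin in auto)
    then have M: "\<Prod>?M \<le> 4 ^ k"
      using dvd_imp_le[of "\<Prod>?M" "2 * k choose k"] binomial_le_pow2[of "2 * k" k]
      by (simp add: power_mult)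
    have "\<Prod>{p. prime p \<and> p \<le> n} dvd \<Prod>(?A \<union> ?M)"
      using k fin by (intro prod_dvd_prod_subset) auto
    then have "\<Prod>{p. prime p \<and> p \<le> n} \<le> \<Prod>(?A \<union> ?M)"
      by (rule dvd_imp_le) (auto intro!: prod_pos simp: prime_gt_0_nat)
    also have "\<dots> = \<Prod>?A * \<Prod>?M" using fin by (intro prod.union_disjoint) auto
    also have "\<dots> \<le> 4 ^ (2 * k) * 4 ^ k" using less.IH[OF k(1)] M by (intro mult_mono) auto
    also have "\<dots> = 4 ^ (3 * k)" by (simp add: power_add[symmetric])
    also have "\<dots> \<le> 4 ^ (2 * n)" using k by (intro power_increasing) auto
    finally show ?thesis .
  qed
qed

text \<open>Without such a prime only primes up to \<open>M\<close> divide
  \<open>Lcm {1..8 * M}\<close>, which is then at most \<open>4 ^ (2 * M)\<close> times a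
  subexponential factor. But it is a positive multiple of \<open>4 * M\<close> times the central
  binomial coefficient of row \<open>8 * M\<close>, hence at least
  \<open>4 ^ (4 * M) / 2\<close>.\<close>

lemma eventually_ex_prime: "\<exists>M0. \<forall>M\<ge>M0. \<exists>p. prime p \<and> M < p \<and> p \<le> 8 * (M::nat)"
proof -
  have "eventually (\<lambda>x::real. (8 * x) powr sqrt (8 * x) < 4 powr (2 * x) / 2) at_top"
    by real_asymp
  then have "eventually (\<lambda>M::nat. (8 * real M) powr sqrt (8 * real M) < 4 powr (2 * real M) / 2) sequentially"
    by (rule eventually_compose_filterlim[OF _ filterlim_real_sequentially])
  then obtain M0 where M0: "\<And>M. M \<ge> M0 \<Longrightarrow> (8 * real M) powr sqrt (8 * real M) < 4 powr (2 * real M) / 2"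
    unfolding eventually_sequentially by blast
  show ?thesis
  proof (rule exI[of _ "max M0 1"], intro allI impI, rule ccontr)
    fix M :: nat assume M: "max M0 1 \<le> M" and none: "\<nexists>p. prime p \<and> M < p \<and> p \<le> 8 * M"
    have eq: "{p. prime p \<and> p \<le> 8 * M} = {p. prime p \<and> p \<le> M}"
      using none by (auto simp: not_less[symmetric])
    have "real (4 * M) * (4 ^ (4 * M) / (2 * real (4 * M))) \<le> real (4 * M) * real (2 * (4 * M) choose (4 * M))"
      using central_binomial_lower_bound[of "4 * M"] M by (intro mult_left_mono) auto
    also have "\<dots> = real (4 * M * (8 * M choose (4 * M)))" by simp
    also have "\<dots> \<le> real (Lcm {1..8 * M})"
      using dvd_imp_le[OF mult_binomial_dvd_Lcm[of "4 * M" "8 * M"]] M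
      by (simp only: of_nat_le_iff) (simp add: Lcm_0_iff neq0_conv[symmetric] del: neq0_conv)
    also have "\<dots> \<le> real (8 * M) powr sqrt (8 * M) * real (\<Prod>{p. prime p \<and> p \<le> M})"
      using Lcm_le_primes[of "8 * M"] M unfolding eq by simp
    also have "\<dots> \<le> real (8 * M) powr sqrt (8 * M) * 4 ^ (2 * M)"
      using of_nat_mono[OF primorial_le[of M], where ?'a = real] by (intro mult_left_mono) auto
    also have "\<dots> < 4 powr (2 * real M) / 2 * 4 ^ (2 * M)"
      using M0[of M] M by (intro mult_strict_right_mono) auto
    also have "4 powr (2 * real M) = (4::real) ^ (2 * M)"
      by (simp add: powr_realpow[symmetric])
    also have "(4::real) ^ (2 * M) / 2 * 4 ^ (2 * M) = real (4 * M) * (4 ^ (4 * M) / (2 * real (4 * M)))"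
      using M by (simp add: power_add[symmetric])
    finally show False by simp
  qed
qed

section \<open>Random polynomials\<close>

text \<open>First moment method: the weight of \<open>h\<close> is its number of zeros times one minus its number
  of bad sets. A positive weight rules out bad sets, and the average weight is positive.\<close>

lemma ex_zero_set_avoiding:
  fixes zs :: "'h \<Rightarrow> 'z set" and q r :: nat
  assumes fin: "finite H" "H \<noteq> {}" "finite Z" "finite B" and q: "q > 0"
    and count: "\<And>T. T \<subseteq> Z \<Longrightarrow> card T \<le> r + 1 \<Longrightarrow> q ^ card T * card {h \<in> H. T \<subseteq> zs h} = card H"
    and B: "\<And>b. b \<in> B \<Longrightarrow> b \<subseteq> Z \<and> card b = r" "4 * card B \<le> q ^ r"
    and large: "q * r < 3 * card Z"
  shows "\<exists>h\<in>H. (\<forall>b\<in>B. \<not> b \<subseteq> zs h) \<and> 3 * card Z \<le> 4 * q * card (Z \<inter> zs h) + q * r"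
proof -
  define e where "e h = (\<Sum>z\<in>Z. of_bool (z \<in> zs h) :: real)" for h
  define N where "N h = (\<Sum>b\<in>B. of_bool (b \<subseteq> zs h) :: real)" for h
  have e_card: "e h = real (card (Z \<inter> zs h))" for h
    unfolding e_def using fin(3) by (simp add: sum.If_cases of_bool_def Int_def)
  have N_card: "N h = real (card {b \<in> B. b \<subseteq> zs h})" for h
    unfolding N_def using fin(4) by (simp add: sum.If_cases of_bool_def Int_def)
  have cnt: "(\<Sum>h\<in>H. of_bool (T \<subseteq> zs h)) = real (card H) / real q ^ card T"
    if "T \<subseteq> Z" "card T \<le> r + 1" for T
  proof -
    have "(\<Sum>h\<in>H. of_bool (T \<subseteq> zs h)) = real (card {h \<in> H. T \<subseteq> zs h})"
      using fin(1) by (simp add: sum.If_cases of_bool_def Int_def)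
    moreover have "real q ^ card T * real (card {h \<in> H. T \<subseteq> zs h}) = real (card H)"
      using count[OF that] by (metis of_nat_mult of_nat_power)
    ultimately show ?thesis using q by (simp add: field_simps)
  qed
  have H0: "real (card H) > 0" using fin by (simp add: card_gt_0_iff)
  define w where "w = real (card Z) / q"
  have "(\<Sum>h\<in>H. e h) = (\<Sum>z\<in>Z. \<Sum>h\<in>H. of_bool ({z} \<subseteq> zs h))"
    unfolding e_def by (subst sum.swap) simp
  also have "\<dots> = (\<Sum>z\<in>Z. real (card H) / real q)"
    using cnt[of "{_}"] by (intro sum.cong) auto
  finally have se: "(\<Sum>h\<in>H. e h) = real (card H) * w" by (simp add: w_def)
  \<comment> \<open>A bad set with one more point of \<open>Z\<close> has \<open>r\<close> or
    \<open>r + 1\<close> elements, which is why \<open>count\<close> has to reach up to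
    \<open>r + 1\<close>.\<close>
  have bz: "(\<Sum>z\<in>Z. \<Sum>h\<in>H. of_bool (insert z b \<subseteq> zs h)) \<le> real (card H) / real q ^ r * (r + w)"
    if b: "b \<in> B" for b
  proof -
    have bZ: "b \<subseteq> Z" "card b = r" "finite b" using B(1)[OF b] fin(3) finite_subset by auto
    have "(\<Sum>z\<in>Z. \<Sum>h\<in>H. of_bool (insert z b \<subseteq> zs h)) =
      (\<Sum>z\<in>Z. real (card H) / real q ^ r * (if z \<in> b then 1 else 1 / q))"
    proof (rule sum.cong)
      fix z assume z: "z \<in> Z"
      then show "(\<Sum>h\<in>H. of_bool (insert z b \<subseteq> zs h)) = real (card H) / real q ^ r * (if z \<in> b then 1 else 1 / q)"
        using cnt[of "insert z b"] bZ by (cases "z \<in> b") (simp_all add: insert_absorb mult.commute)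
    qed simp
    also have "\<dots> \<le> real (card H) / real q ^ r * (\<Sum>z\<in>Z. (if z \<in> b then 1 else 0) + 1 / q)"
      unfolding sum_distrib_left[symmetric] by (intro mult_left_mono sum_mono) auto
    also have "(\<Sum>z\<in>Z. (if z \<in> b then 1 else 0) + 1 / real q) = r + w"
      using fin(3) bZ by (simp add: sum.distrib sum.If_cases w_def Int_absorb1)
    finally show ?thesis .
  qed
  have "(\<Sum>h\<in>H. e h * N h) = (\<Sum>h\<in>H. \<Sum>b\<in>B. \<Sum>z\<in>Z. of_bool (insert z b \<subseteq> zs h))"
  proof (rule sum.cong)
    fix h
    have "e h * N h = (\<Sum>b\<in>B. \<Sum>z\<in>Z. of_bool (z \<in> zs h) * of_bool (b \<subseteq> zs h))"
      unfolding e_def N_def by (simp add: sum_product sum.swap[of _ B])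
    then show "e h * N h = (\<Sum>b\<in>B. \<Sum>z\<in>Z. of_bool (insert z b \<subseteq> zs h))"
      by (simp add: of_bool_conj)
  qed simp
  also have "\<dots> = (\<Sum>b\<in>B. \<Sum>z\<in>Z. \<Sum>h\<in>H. of_bool (insert z b \<subseteq> zs h))"
    by (subst sum.swap, subst (2) sum.swap) simp
  also have "\<dots> \<le> real (card B) * (real (card H) / real q ^ r * (r + w))"
    using sum_bounded_above[OF bz] by simp
  also have "\<dots> \<le> (real q ^ r / 4) * (real (card H) / real q ^ r * (r + w))"
  proof (rule mult_right_mono)
    have "real (4 * card B) \<le> real (q ^ r)" using B(2) by (simp only: of_nat_le_iff)
    then show "real (card B) \<le> real q ^ r / 4" by simp
  qed (simp add: w_def)
  also have "\<dots> = real (card H) * ((r + w) / 4)" using q by simp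
  finally have sN: "(\<Sum>h\<in>H. e h * N h) \<le> real (card H) * ((r + w) / 4)" .
  \<comment> \<open>Here \<open>w\<close> is the average number of zeros, and the average of
    \<open>e h * (1 - N h)\<close> is at least \<open>w - (r + w) / 4\<close>.\<close>
  have "\<exists>h\<in>H. 3 / 4 * w - r / 4 \<le> e h * (1 - N h)"
  proof (rule ccontr)
    assume "\<not> ?thesis"
    then have "(\<Sum>h\<in>H. e h * (1 - N h)) < (\<Sum>h\<in>H. 3 / 4 * w - r / 4)"
      using fin by (intro sum_strict_mono) auto
    then have "(\<Sum>h\<in>H. e h) - (\<Sum>h\<in>H. e h * N h) < real (card H) * (3 / 4 * w - r / 4)"
      by (simp add: sum_subtractf right_diff_distrib)
    then have "real (card H) * w - real (card H) * ((r + w) / 4) < real (card H) * (3 / 4 * w - r / 4)"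
      using se sN by linarith
    then show False using H0 by (simp add: field_simps)
  qed
  then obtain h where h: "h \<in> H" "3 / 4 * w - r / 4 \<le> e h * (1 - N h)" by blast
  have "real (q * r) < real (3 * card Z)" using large by (simp only: of_nat_less_iff)
  then have pos: "3 / 4 * w - r / 4 > 0" using q by (simp add: w_def field_simps)
  have N0: "card {b \<in> B. b \<subseteq> zs h} = 0"
  proof (rule ccontr)
    assume "\<not> ?thesis"
    then have "N h \<ge> 1" unfolding N_card by simp
    then have "e h * (1 - N h) \<le> 0" using e_card by (intro mult_nonneg_nonpos) auto
    then show False using h pos by linarith
  qed
  then have "3 / 4 * w - r / 4 \<le> real (card (Z \<inter> zs h))" using h N_card[of h] e_card[of h] by simp
  then have "real (3 * card Z) \<le> real (4 * q * card (Z \<inter> zs h) + q * r)"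
    using q by (simp add: w_def field_simps)
  then have "3 * card Z \<le> 4 * q * card (Z \<inter> zs h) + q * r" by (simp only: of_nat_le_iff)
  moreover have "\<forall>b\<in>B. \<not> b \<subseteq> zs h" using N0 fin(4) by auto
  ultimately show ?thesis using h by blast
qed

section \<open>Dense biclique-free graphs over a finite field\<close>

context plain_field
begin

text \<open>The bad sets are the grids of \<open>s^2\<close> points over pairs of
  \<open>s\<close>-sets, where \<open>s = d1 + d2\<close>. The bounds on \<open>m\<close> and
  \<open>n\<close> make room for \<open>P\<close> and \<open>Q\<close> and also limit the number of
  grids; \<open>large\<close> absorbs the error \<open>q * r\<close> of the first moment argument
  into \<open>m * n\<close>.\<close>

lemma ex_biclique_free_algebraic_graph:
  assumes q: "finite (carrier R)" "card (carrier R) = q"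
    and d: "d1 \<ge> 1" "d2 \<ge> 1" and m: "m \<le> q ^ d1" and n: "n \<le> q ^ d2"
    and large: "q * (d1 + d2)^2 \<le> m * n" "m \<ge> 1" "n \<ge> 1"
  shows "\<exists>P Q E. algebraic_graph_le R d1 d2 ((d1 + d2)^2) P Q E \<and>
    finite P \<and> finite Q \<and> card P = m \<and> card Q = n \<and>
    (\<forall>s\<ge>d1 + d2. biclique_free s (Sum_Type.Plus P Q) E) \<and> m * n \<le> 2 * q * card E"
proof -
  define s where "s = d1 + d2"
  define r where "r = s ^ 2"
  have s: "s \<ge> 2" using d by (simp add: s_def)
  have r: "r \<ge> 1" using s by (simp add: r_def)
  have aff: "finite (affine_space R d)" "card (affine_space R d) = q ^ d" for d
    unfolding affine_space_def using q by (simp_all add: finite_PiE card_PiE)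
  obtain P where P: "P \<subseteq> affine_space R d1" "card P = m" "finite P"
    using obtain_subset_with_card_n[of m "affine_space R d1"] m aff by auto
  obtain Q where Q: "Q \<subseteq> affine_space R d2" "card Q = n" "finite Q"
    using obtain_subset_with_card_n[of n "affine_space R d2"] n aff by auto
  define I :: "(nat + nat) set" where "I = Sum_Type.Plus {..<d1} {..<d2}"
  define pt :: "(nat \<Rightarrow> 'a) \<times> (nat \<Rightarrow> 'a) \<Rightarrow> nat + nat \<Rightarrow> 'a" where "pt = (\<lambda>(x, y). case_sum x y)"
  define Z where "Z = pt ` (P \<times> Q)"
  have fI: "finite I" by (simp add: I_def)
  have fZ: "finite Z" using P Q by (simp add: Z_def)
  have inj: "inj pt"
    unfolding pt_def inj_def by (auto simp: fun_eq_iff split: sum.splits)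
  have ZI: "Z \<subseteq> I \<rightarrow> carrier R"
    using P Q unfolding Z_def pt_def I_def affine_space_def by (fastforce simp: PiE_iff)
  have sep: "\<exists>v\<in>I. z v \<noteq> w v" if z: "z \<in> Z" and w: "w \<in> Z" and ne: "z \<noteq> w" for z w
  proof (rule ccontr)
    assume "\<not> ?thesis"
    then have eq: "\<And>v. v \<in> I \<Longrightarrow> z v = w v" by blast
    obtain x y x' y' where xy: "z = case_sum x y" "w = case_sum x' y'" "x \<in> P" "y \<in> Q" "x' \<in> P" "y' \<in> Q"
      using z w unfolding Z_def pt_def by auto
    have "x = x'"
    proof (rule PiE_ext)
      show "x \<in> {..<d1} \<rightarrow>\<^sub>E carrier R" "x' \<in> {..<d1} \<rightarrow>\<^sub>E carrier R"
        using xy P by (auto simp: affine_space_def)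
      show "x i = x' i" if "i \<in> {..<d1}" for i using eq[of "Inl i"] that xy by (auto simp: I_def)
    qed
    moreover have "y = y'"
    proof (rule PiE_ext)
      show "y \<in> {..<d2} \<rightarrow>\<^sub>E carrier R" "y' \<in> {..<d2} \<rightarrow>\<^sub>E carrier R"
        using xy Q by (auto simp: affine_space_def)
      show "y i = y' i" if "i \<in> {..<d2}" for i using eq[of "Inr i"] that xy by (auto simp: I_def)
    qed
    ultimately show False using ne xy by simp
  qed
  define H where "H = restricted_poly_funs I r Z"
  define zs where "zs h = {z \<in> Z. h z = \<zero>}" for h :: "(nat + nat \<Rightarrow> 'a) \<Rightarrow> 'a"
  define \<A> where "\<A> = {A. A \<subseteq> P \<and> card A = s}"
  define \<B> where "\<B> = {B. B \<subseteq> Q \<and> card B = s}"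
  define bad where "bad = (\<lambda>(A, B). pt ` (A \<times> B)) ` (\<A> \<times> \<B>)"
  have fAB: "finite \<A>" "finite \<B>" using P Q by (simp_all add: \<A>_def \<B>_def)
  have q0: "q > 0" using q one_closed by (metis card_gt_0_iff empty_iff)
  have "\<exists>h\<in>H. (\<forall>b\<in>bad. \<not> b \<subseteq> zs h) \<and> 3 * card Z \<le> 4 * q * card (Z \<inter> zs h) + q * r"
  proof (rule ex_zero_set_avoiding)
    show "finite H" unfolding H_def using q fZ ZI by (intro finite_restricted_poly_funs) auto
    show "H \<noteq> {}" unfolding H_def restricted_poly_funs_def using poly_funs_zero by blast
    show "finite Z" "finite bad" "q > 0" using fZ fAB q0 by (auto simp: bad_def)
    show "q ^ card T * card {h \<in> H. T \<subseteq> zs h} = card H" if T: "T \<subseteq> Z" "card T \<le> r + 1" for T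
    proof -
      have "{h \<in> H. T \<subseteq> zs h} = {h \<in> H. \<forall>z\<in>T. h z = \<zero>}" using T by (auto simp: zs_def)
      moreover have "q ^ card T * card {h \<in> H. \<forall>z\<in>T. h z = \<zero>} = card H"
        unfolding H_def q(2)[symmetric]
        by (rule card_vanishing_restricted_poly_funs[OF fI q(1) fZ ZI]) (use sep T in auto)
      ultimately show ?thesis by simp
    qed
    show "b \<subseteq> Z \<and> card b = r" if "b \<in> bad" for b
    proof -
      obtain A B where AB: "A \<subseteq> P" "B \<subseteq> Q" "card A = s" "card B = s" "b = pt ` (A \<times> B)"
        using \<open>b \<in> bad\<close> unfolding bad_def \<A>_def \<B>_def by auto
      have "card b = card (A \<times> B)" unfolding AB(5) using inj by (intro card_image) (auto intro: inj_on_subset)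
      then show ?thesis using AB by (auto simp: r_def card_cartesian_product power2_eq_square Z_def)
    qed
    show "4 * card bad \<le> q ^ r"
    proof -
      \<comment> \<open>As \<open>s \<ge> 2\<close>, each binomial coefficient is at most half of
        the power; the two halves supply the factor 4 required of the number of bad sets.\<close>
      have choose: "2 * (k choose s) \<le> k ^ s" for k
      proof -
        have "fact 2 \<le> (fact s :: nat)" using s by (intro fact_mono_nat)
        then have "(k choose s) * 2 \<le> (k choose s) * fact s" by (intro mult_left_mono) auto
        then show ?thesis using binomial_fact_pow[of k s] by linarith
      qed
      have "card bad \<le> card (\<A> \<times> \<B>)" unfolding bad_def using fAB by (intro card_image_le) auto
      also have "\<dots> = (m choose s) * (n choose s)"
        using P Q by (simp add: \<A>_def \<B>_def card_cartesian_product n_subsets)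
      finally have "4 * card bad \<le> (2 * (m choose s)) * (2 * (n choose s))" by simp
      also have "\<dots> \<le> m ^ s * n ^ s" using choose by (intro mult_mono) auto
      also have "\<dots> \<le> (q ^ d1) ^ s * (q ^ d2) ^ s" using m n by (intro mult_mono power_mono) auto
      also have "\<dots> = q ^ r"
        by (simp add: r_def s_def power_mult[symmetric] power_add[symmetric] power2_eq_square distrib_right[symmetric])
      finally show ?thesis .
    qed
    have "card Z = m * n" unfolding Z_def using inj P Q
      by (subst card_image) (auto intro: inj_on_subset simp: card_cartesian_product)
    moreover have "q * r > 0" using q0 r by simp
    ultimately show "q * r < 3 * card Z" using large(1) unfolding r_def s_def by linarith
  qed
  then obtain h where h: "h \<in> H" "\<And>b. b \<in> bad \<Longrightarrow> \<not> b \<subseteq> zs h"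
    "3 * card Z \<le> 4 * q * card (Z \<inter> zs h) + q * r" by blast
  obtain g where g: "g \<in> poly_funs I r" "h = restrict g Z"
    using h(1) unfolding H_def restricted_poly_funs_def by blast
  obtain f where f: "f \<in> indexed_pset I (carrier R)" "total_degree_le R f r"
    "\<And>z. z \<in> I \<rightarrow> carrier R \<Longrightarrow> indexed_poly_eval R f z = g z"
    using poly_funs_imp_indexed_poly[OF fI g(1)] by blast
  \<comment> \<open>Complexity \<open>r\<close> asks for a list of exactly \<open>r\<close>
    polynomials, so the single polynomial is repeated and \<open>hd\<close> reads off its truth
    value.\<close>
  define fs where "fs = replicate r f"
  define E where "E = zero_pattern_edges R fs hd P Q"
  have adj: "zero_pattern_adj R fs hd (case_sum x y) \<longleftrightarrow> pt (x, y) \<in> zs h" if "x \<in> P" "y \<in> Q" for x y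
  proof -
    have z: "pt (x, y) \<in> Z" using that by (auto simp: Z_def)
    have "zero_pattern_adj R fs hd (case_sum x y) \<longleftrightarrow> indexed_poly_eval R f (pt (x, y)) = \<zero>"
      using r unfolding zero_pattern_adj_def fs_def by (cases r) (simp_all add: pt_def)
    also have "\<dots> \<longleftrightarrow> pt (x, y) \<in> zs h" using f(3) ZI z g(2) by (auto simp: zs_def)
    finally show ?thesis .
  qed
  have "algebraic_graph R d1 d2 r P Q E"
    unfolding algebraic_graph_def bipoly_set_def
    using P Q f(1,2) by (intro conjI exI[of _ fs] exI[of _ hd]) (auto simp: fs_def E_def I_def)
  then have graph: "algebraic_graph_le R d1 d2 r P Q E" unfolding algebraic_graph_le_def by blast
  have free: "biclique_free s' (Sum_Type.Plus P Q) E" if "s' \<ge> s" for s'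
  proof -
    have "s' \<ge> 1" using that s by simp
    moreover have "\<exists>x\<in>A. \<exists>y\<in>B. \<not> zero_pattern_adj R fs hd (case_sum x y)"
      if AB: "A \<subseteq> P" "B \<subseteq> Q" "card A = s'" "card B = s'" for A B
    proof (rule ccontr)
      assume all: "\<not> ?thesis"
      obtain A' where A': "A' \<subseteq> A" "card A' = s"
        using obtain_subset_with_card_n[of s A] AB \<open>s' \<ge> s\<close> by auto
      obtain B' where B': "B' \<subseteq> B" "card B' = s"
        using obtain_subset_with_card_n[of s B] AB \<open>s' \<ge> s\<close> by auto
      have "pt ` (A' \<times> B') \<in> bad" unfolding bad_def \<A>_def \<B>_def using A' B' AB by blast
      moreover have "pt ` (A' \<times> B') \<subseteq> zs h" using all adj A' B' AB by blast
      ultimately show False using h(2) by blast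
    qed
    ultimately show ?thesis unfolding E_def by (simp add: biclique_free_zero_pattern_edges)
  qed
  have "card (Z \<inter> zs h) = card E"
  proof -
    let ?S = "{(x, y). x \<in> P \<and> y \<in> Q \<and> zero_pattern_adj R fs hd (case_sum x y)}"
    have "Z \<inter> zs h = pt ` ?S"
    proof (intro equalityI subsetI)
      fix z assume z: "z \<in> Z \<inter> zs h"
      then obtain x y where "x \<in> P" "y \<in> Q" "z = pt (x, y)" unfolding Z_def by blast
      then show "z \<in> pt ` ?S" using adj z by blast
    next
      fix z assume "z \<in> pt ` ?S"
      then obtain x y where "x \<in> P" "y \<in> Q" "z = pt (x, y)" "zero_pattern_adj R fs hd (case_sum x y)" by blast
      then show "z \<in> Z \<inter> zs h" using adj unfolding Z_def by blast
    qed
    moreover have "card (pt ` ?S) = card ?S" using inj by (intro card_image) (auto intro: inj_on_subset)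
    ultimately show ?thesis unfolding E_def card_zero_pattern_edges by simp
  qed
  moreover have "card Z = m * n" unfolding Z_def using inj P Q
    by (subst card_image) (auto intro: inj_on_subset simp: card_cartesian_product)
  ultimately have "3 * (m * n) \<le> 4 * q * card E + m * n"
    using h(3) large(1) unfolding r_def s_def by simp
  then have "m * n \<le> 2 * q * card E" by simp
  then show ?thesis using graph free P Q unfolding r_def s_def by blast
qed

end

text \<open>With \<open>x\<close> the larger of the roots \<open>a\<close> and \<open>b\<close>, the
  target \<open>zarankiewicz_term\<close> is at most \<open>m * n / x\<close>, and the random graph
  has at least \<open>m * n / (2 * q)\<close> edges. A prime \<open>q \<le> 16 * x\<close> therefore
  gives the constant \<open>1 / 32\<close> for all dimensions.\<close>

lemma zarankiewicz_lower_bound: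
  assumes d: "d1 \<ge> 1" "d2 \<ge> 1"
  shows "\<exists>N. \<forall>m\<ge>N. \<forall>n\<ge>N. \<exists>(R :: int ring) P Q E.
    field R \<and> algebraic_graph_le R d1 d2 ((d1 + d2)^2) P Q E \<and>
    finite P \<and> finite Q \<and> card P = m \<and> card Q = n \<and>
    (\<forall>s\<ge>d1 + d2. biclique_free s (Sum_Type.Plus P Q) E) \<and>
    1 / 32 * zarankiewicz_term d1 d2 m n \<le> real (card E)"
proof -
  obtain M0 where M0: "\<And>M. M \<ge> M0 \<Longrightarrow> \<exists>p. prime p \<and> M < p \<and> p \<le> 8 * (M::nat)"
    using eventually_ex_prime by blast
  define r where "r = (d1 + d2)^2"
  show ?thesis
  \<comment> \<open>The entry \<open>M0 ^ d1\<close> makes \<open>a\<close>, and with it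
    \<open>M\<close>, at least \<open>M0\<close>. The entry \<open>16 * r\<close> yields
    \<open>q * r \<le> m * n\<close>: \<open>x\<close> is at most one of \<open>m\<close> and
    \<open>n\<close>, and the other is at least \<open>16 * r\<close>.\<close>
  proof (rule exI[of _ "max (16 * r) (max (M0 ^ d1) 1)"], intro allI impI)
    fix m n :: nat
    assume mN: "max (16 * r) (max (M0 ^ d1) 1) \<le> m" and nN: "max (16 * r) (max (M0 ^ d1) 1) \<le> n"
    define a b where "a = real m powr (1 / d1)" and "b = real n powr (1 / d2)"
    define x where "x = max a b"
    have mn: "real m \<ge> 1" "real n \<ge> 1" using mN nN by auto
    have ab: "1 \<le> a" "a \<le> m" "1 \<le> b" "b \<le> n"
      using mn d powr_mono[of "1 / d1" 1 m] powr_mono[of "1 / d2" 1 n]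
      by (auto simp: a_def b_def ge_one_powr_ge_zero)
    have a_pow: "a ^ d1 = m" and b_pow: "b ^ d2 = n"
      using mn d by (simp_all add: a_def b_def powr_realpow[symmetric] powr_powr)
    define M where "M = nat \<lceil>x\<rceil>"
    have x1: "x \<ge> 1" using ab by (simp add: x_def)
    have Mx: "x \<le> M" "M \<le> 2 * x" using x1 unfolding M_def by linarith+
    have "real M0 ^ d1 \<le> a ^ d1"
    proof -
      have "M0 ^ d1 \<le> m" using mN by simp
      then have "real (M0 ^ d1) \<le> real m" by (simp only: of_nat_le_iff)
      then show ?thesis by (simp add: a_pow)
    qed
    then have "real M0 \<le> a" using d ab power_mono_iff[of "real M0" a d1] by simp
    then have "M0 \<le> M" using Mx by (simp add: x_def)
    then obtain q where q: "prime q" "M < q" "q \<le> 8 * M" using M0 by blast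
    have xq: "x \<le> q" "q \<le> 16 * x" using q Mx by linarith+
    have mq: "m \<le> q ^ d1"
    proof -
      have "a ^ d1 \<le> real q ^ d1" using ab xq by (intro power_mono) (auto simp: x_def)
      then show ?thesis unfolding a_pow by (metis of_nat_le_iff of_nat_power)
    qed
    have nq: "n \<le> q ^ d2"
    proof -
      have "b ^ d2 \<le> real q ^ d2" using ab xq by (intro power_mono) (auto simp: x_def)
      then show ?thesis unfolding b_pow by (metis of_nat_le_iff of_nat_power)
    qed
    have "x * (16 * r) \<le> real m * real n"
    proof (cases "a \<le> b")
      case True
      have "16 * real r \<le> m" using mN by linarith
      then have "b * (16 * r) \<le> real n * real m" using ab by (intro mult_mono) auto
      then show ?thesis using True by (simp add: x_def max_def mult.commute)
    next
      case False
      have "16 * real r \<le> n" using nN by linarith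
      then have "a * (16 * r) \<le> real m * real n" using ab by (intro mult_mono) auto
      then show ?thesis using False by (simp add: x_def max_def)
    qed
    moreover have "real q * r \<le> (16 * x) * r" using xq by (intro mult_right_mono) auto
    ultimately have "real (q * r) \<le> real (m * n)" by simp
    then have large: "q * (d1 + d2)^2 \<le> m * n" unfolding r_def by (simp only: of_nat_le_iff)
    \<comment> \<open>The residues live inside \<open>int\<close>, so the type of the record is the
      same for every prime.\<close>
    define R where "R = residue_ring (int q)"
    interpret R: residues_prime q R
      by unfold_locales (use q in \<open>simp_all add: R_def\<close>)
    interpret R: plain_field R using R.is_field by (simp add: plain_field_def)
    have "finite (carrier R)" "card (carrier R) = q" by (simp_all add: R_def residue_ring_def)
    from R.ex_biclique_free_algebraic_graph[OF this d mq nq large]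
    obtain P Q E where G: "algebraic_graph_le R d1 d2 ((d1 + d2)^2) P Q E"
      "finite P" "finite Q" "card P = m" "card Q = n"
      "\<forall>s\<ge>d1 + d2. biclique_free s (Sum_Type.Plus P Q) E" "m * n \<le> 2 * q * card E"
      using mN nN by auto
    have "zarankiewicz_term d1 d2 m n * x \<le> real m * real n"
    proof (cases "a \<le> b")
      case True
      have "real n powr (1 - 1 / d2) * b = n" using mn by (simp add: b_def powr_add[symmetric])
      then have eq: "real m * real n powr (1 - 1 / d2) * b = real m * real n" by (simp add: mult.assoc)
      have "zarankiewicz_term d1 d2 m n * b \<le> real m * real n powr (1 - 1 / d2) * b"
        using ab by (intro mult_right_mono) (auto simp: zarankiewicz_term_def)
      then have "zarankiewicz_term d1 d2 m n * b \<le> real m * real n" unfolding eq .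
      then show ?thesis using True by (simp add: x_def max_def)
    next
      case False
      have "real m powr (1 - 1 / d1) * a = m" using mn by (simp add: a_def powr_add[symmetric])
      then have eq: "real m powr (1 - 1 / d1) * real n * a = real m * real n" by (simp add: mult_ac)
      have "zarankiewicz_term d1 d2 m n * a \<le> real m powr (1 - 1 / d1) * real n * a"
        using ab by (intro mult_right_mono) (auto simp: zarankiewicz_term_def)
      then have "zarankiewicz_term d1 d2 m n * a \<le> real m * real n" unfolding eq .
      then show ?thesis using False by (simp add: x_def max_def)
    qed
    also have "real m * real n \<le> 2 * real q * card E"
      using G(7) by (metis of_nat_le_iff of_nat_mult of_nat_numeral)
    also have "\<dots> \<le> 2 * (16 * x) * card E" using xq by (intro mult_right_mono mult_left_mono) auto
    finally have "zarankiewicz_term d1 d2 m n * x \<le> (32 * card E) * x" by (simp add: mult_ac)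
    then have "zarankiewicz_term d1 d2 m n \<le> 32 * card E" using x1 by simp
    then have "1 / 32 * zarankiewicz_term d1 d2 m n \<le> card E" by simp
    then show "\<exists>(R :: int ring) P Q E.
      field R \<and> algebraic_graph_le R d1 d2 ((d1 + d2)^2) P Q E \<and>
      finite P \<and> finite Q \<and> card P = m \<and> card Q = n \<and>
      (\<forall>s\<ge>d1 + d2. biclique_free s (Sum_Type.Plus P Q) E) \<and>
      1 / 32 * zarankiewicz_term d1 d2 m n \<le> real (card E)"
      using G(1-6) R.is_field by blast
  qed
qed

theorem theorem1p8:
  shows
    "(\<forall>d1\<ge>1. \<forall>d2\<ge>1. \<forall>t s. \<exists>C>0.
        \<forall>(R :: 'a ring) P Q E m n.
          field R \<longrightarrow> algebraic_graph_le R d1 d2 t P Q E \<longrightarrow>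
          finite P \<longrightarrow> finite Q \<longrightarrow> card P = m \<longrightarrow> card Q = n \<longrightarrow>
          biclique_free s (P <+> Q) E \<longrightarrow>
          real (card E) \<le> C * (zarankiewicz_term d1 d2 m n + real m + real n))
     \<and>
     (\<exists>c>0. \<forall>d1\<ge>1. \<forall>d2\<ge>1. \<exists>t N.
        \<forall>m\<ge>N. \<forall>n\<ge>N. \<forall>s\<ge>d1 + d2.
          \<exists>(R :: int ring) P Q E.
            field R \<and> algebraic_graph_le R d1 d2 t P Q E \<and>
            finite P \<and> finite Q \<and> card P = m \<and> card Q = n \<and>
            biclique_free s (P <+> Q) E \<and>
            c * zarankiewicz_term d1 d2 m n \<le> real (card E))"
proof
  show "\<forall>d1\<ge>1. \<forall>d2\<ge>1. \<forall>t s. \<exists>C>0.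
        \<forall>(R :: 'a ring) P Q E m n.
          field R \<longrightarrow> algebraic_graph_le R d1 d2 t P Q E \<longrightarrow>
          finite P \<longrightarrow> finite Q \<longrightarrow> card P = m \<longrightarrow> card Q = n \<longrightarrow>
          biclique_free s (P <+> Q) E \<longrightarrow>
          real (card E) \<le> C * (zarankiewicz_term d1 d2 m n + real m + real n)"
  proof (intro allI impI)
    fix d1 d2 t s :: nat assume d: "1 \<le> d1" "1 \<le> d2"
    let ?C = "edge_const t s d1 + edge_const t s d2"
    show "\<exists>C>0. \<forall>(R :: 'a ring) P Q E m n.
          field R \<longrightarrow> algebraic_graph_le R d1 d2 t P Q E \<longrightarrow>
          finite P \<longrightarrow> finite Q \<longrightarrow> card P = m \<longrightarrow> card Q = n \<longrightarrow>
          biclique_free s (P <+> Q) E \<longrightarrow>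
          real (card E) \<le> C * (zarankiewicz_term d1 d2 m n + real m + real n)"
    \<comment> \<open>The statement wants a positive constant, and \<open>?C\<close> is zero when
      \<open>s = 0\<close> and \<open>d1 = d2 = 1\<close>; hence the added one.\<close>
    proof (intro exI[of _ "?C + 1"] conjI allI impI)
      have C: "?C \<ge> 0" by (auto simp: edge_const_def deg_const_def)
      then show "?C + 1 > 0" by simp
      fix R :: "'a ring" and P Q E and m n :: nat
      assume "field R" and *: "algebraic_graph_le R d1 d2 t P Q E" "finite P" "finite Q"
        "card P = m" "card Q = n" "biclique_free s (P <+> Q) E"
      then interpret plain_field R by (simp add: plain_field_def)
      have "real (card E) \<le> ?C * (zarankiewicz_term d1 d2 m n + real m + real n)"
        using algebraic_graph_card_edges_le[OF *(1-3,6) d] *(4,5) by simp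
      also have "\<dots> \<le> (?C + 1) * (zarankiewicz_term d1 d2 m n + real m + real n)"
        by (intro mult_right_mono) (auto simp: zarankiewicz_term_def)
      finally show "real (card E) \<le> (?C + 1) * (zarankiewicz_term d1 d2 m n + real m + real n)" .
    qed
  qed
next
  show "\<exists>c>0. \<forall>d1\<ge>1. \<forall>d2\<ge>1. \<exists>t N.
        \<forall>m\<ge>N. \<forall>n\<ge>N. \<forall>s\<ge>d1 + d2.
          \<exists>(R :: int ring) P Q E.
            field R \<and> algebraic_graph_le R d1 d2 t P Q E \<and>
            finite P \<and> finite Q \<and> card P = m \<and> card Q = n \<and>
            biclique_free s (P <+> Q) E \<and>
            c * zarankiewicz_term d1 d2 m n \<le> real (card E)"
  proof (rule exI[of _ "1 / 32"], intro conjI allI impI)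
    fix d1 d2 :: nat assume "1 \<le> d1" "1 \<le> d2"
    \<comment> \<open>One graph is free for every \<open>s \<ge> d1 + d2\<close> at once, so
      \<open>t\<close> and the threshold do not depend on \<open>s\<close>.\<close>
    from zarankiewicz_lower_bound[OF this] show "\<exists>t N.
        \<forall>m\<ge>N. \<forall>n\<ge>N. \<forall>s\<ge>d1 + d2.
          \<exists>(R :: int ring) P Q E.
            field R \<and> algebraic_graph_le R d1 d2 t P Q E \<and>
            finite P \<and> finite Q \<and> card P = m \<and> card Q = n \<and>
            biclique_free s (P <+> Q) E \<and>
            1 / 32 * zarankiewicz_term d1 d2 m n \<le> real (card E)"
      by meson
  qed simp
qed

end
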